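(* Let $A$, $B$, $A_1$, $B_1$, $B_2$, $B_3$, $C_1$, $C_1-A_1$ and $\mathbb{Y}$ be positive stable matrices in $\mathbb{C}^{r\times r}$ with $A_1C_1=C_1A_1$, and let $z,w,v\in\mathbb{C}$ with $|z|<1$, $|w|<1$, $|v|<1$. Then $$\begin{aligned}F^{(3;A,B)}_{D,\mathbb{Y}}(A_1,B_1,B_2,B_3;C_1;z,w,v)=\int_0^1&{}_1F_1\!\left(A;B;-\frac{\mathbb{Y}}{u(1-u)}\right)u^{A_1-I}(1-u)^{C_1-A_1-I}[\mathfrak{B}(A_1,C_1-A_1)]^{-1}\\&\times(1-zu)^{-B_1}(1-wu)^{-B_2}(1-vu)^{-B_3}\,du.\end{aligned}$$
   Context: A matrix in $\mathbb{C}^{r\times r}$ is positive stable if all its eigenvalues have positive real part; $I$ is the identity matrix. For a matrix $M$ and a complex number $s\notin(-\infty,0]$, $s^M=\exp(M\log s)$ with the principal logarithm. The Pochhammer symbol is $(M)_0=I$, $(M)_n=M(M+I)\cdots(M+(n-1)I)$ for $n\ge1$. For positive stable $B$ and a square matrix $W$, ${}_1F_1(A;B;W)=\sum_{n\ge0}(A)_n\,[(B)_n]^{-1}\,\frac{W^n}{n!}$. For commuting positive stable $P,Q$, the beta matrix function is $\mathfrak{B}(P,Q)=\Gamma(P)\Gamma(Q)\Gamma^{-1}(P+Q)=\int_0^1t^{P-I}(1-t)^{Q-I}dt$, where $\Gamma(P)=\int_0^\infty e^{-t}t^{P-I}dt$. For positive stable $A,B,P,Q,\mathbb{Y}$, $$\mathfrak{B}_{\mathbb{Y}}^{(A,B)}(P,Q)=\int_0^1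 {}_1F_1\!\left(A;B;-\frac{\mathbb{Y}}{t(1-t)}\right)t^{P-I}(1-t)^{Q-I}\,dt .$$ The new extended Lauricella matrix function of three variables is $$\begin{aligned}F^{(3;A,B)}_{D,\mathbb{Y}}(A_1,B_1,B_2,B_3;C_1;z,w,v)=\sum_{m,n,p\ge0}&\mathfrak{B}_{\mathbb{Y}}^{(A,B)}(A_1+(m+n+p)I,C_1-A_1)[\mathfrak{B}(A_1,C_1-A_1)]^{-1}\\&\times(B_1)_m(B_2)_n(B_3)_p\frac{z^mw^nv^p}{m!\,n!\,p!}.\end{aligned}$$ *)

theory Defs
  imports "HOL-Analysis.Analysis"
begin

text \<open>
  The product, unit and powers that \<^typ>\<open>complex ^ 'n ^ 'n\<close> inherits from its type class
  instances are componentwise, so the matrix product \<open>**\<close> and the identity \<open>mat 1\<close> are used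
  throughout, and powers and the exponential are defined from them.
\<close>

definition positive_stable :: "complex ^ 'n ^ 'n \<Rightarrow> bool" where
  "positive_stable M \<longleftrightarrow> (\<forall>c x. x \<noteq> 0 \<and> M *v x = c *s x \<longrightarrow> 0 < Re c)"

definition mscale :: "complex \<Rightarrow> complex ^ 'n ^ 'n \<Rightarrow> complex ^ 'n ^ 'n" where
  "mscale c M = map_matrix (\<lambda>x. c * x) M"

primrec mpow :: "complex ^ 'n ^ 'n \<Rightarrow> nat \<Rightarrow> complex ^ 'n ^ 'n" where
  "mpow M 0 = mat 1"
| "mpow M (Suc n) = mpow M n ** M"

definition mexp :: "complex ^ 'n ^ 'n \<Rightarrow> complex ^ 'n ^ 'n" where
  "mexp M = (\<Sum>n. mscale (1 / fact n) (mpow M n))"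

text \<open>\<open>s\<^sup>M\<close>, meaningful for \<open>s\<close> off the closed negative real axis; \<^const>\<open>Ln\<close> is the principal branch.\<close>

definition mpowr :: "complex \<Rightarrow> complex ^ 'n ^ 'n \<Rightarrow> complex ^ 'n ^ 'n" where
  "mpowr s M = mexp (mscale (Ln s) M)"

primrec mpochhammer :: "complex ^ 'n ^ 'n \<Rightarrow> nat \<Rightarrow> complex ^ 'n ^ 'n" where
  "mpochhammer M 0 = mat 1"
| "mpochhammer M (Suc n) = mpochhammer M n ** (M + mat (of_nat n))"

definition hyp1F1 ::
  "complex ^ 'n ^ 'n \<Rightarrow> complex ^ 'n ^ 'n \<Rightarrow> complex ^ 'n ^ 'n \<Rightarrow> complex ^ 'n ^ 'n" where
  "hyp1F1 A B W =
     (\<Sum>n. mpochhammer A n ** matrix_inv (mpochhammer B n) ** mscale (1 / fact n) (mpow W n))"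

definition mGamma :: "complex ^ 'n ^ 'n \<Rightarrow> complex ^ 'n ^ 'n" where
  "mGamma P = (LBINT t:{0<..}. mscale (of_real (exp (- t))) (mpowr (of_real t) (P - mat 1)))"

definition mBeta :: "complex ^ 'n ^ 'n \<Rightarrow> complex ^ 'n ^ 'n \<Rightarrow> complex ^ 'n ^ 'n" where
  "mBeta P Q = mGamma P ** mGamma Q ** matrix_inv (mGamma (P + Q))"

definition ext_mBeta_integrand ::
  "complex ^ 'n ^ 'n \<Rightarrow> complex ^ 'n ^ 'n \<Rightarrow> complex ^ 'n ^ 'n \<Rightarrow>
   complex ^ 'n ^ 'n \<Rightarrow> complex ^ 'n ^ 'n \<Rightarrow> real \<Rightarrow> complex ^ 'n ^ 'n" where
  "ext_mBeta_integrand A B Y P Q t =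
     hyp1F1 A B (mscale (of_real (- 1 / (t * (1 - t)))) Y)
       ** mpowr (of_real t) (P - mat 1) ** mpowr (of_real (1 - t)) (Q - mat 1)"

definition ext_mBeta ::
  "complex ^ 'n ^ 'n \<Rightarrow> complex ^ 'n ^ 'n \<Rightarrow> complex ^ 'n ^ 'n \<Rightarrow>
   complex ^ 'n ^ 'n \<Rightarrow> complex ^ 'n ^ 'n \<Rightarrow> complex ^ 'n ^ 'n" where
  "ext_mBeta A B Y P Q = (LBINT t:{0<..<1}. ext_mBeta_integrand A B Y P Q t)"

definition lauricella_FD3_term ::
  "complex ^ 'n ^ 'n \<Rightarrow> complex ^ 'n ^ 'n \<Rightarrow> complex ^ 'n ^ 'n \<Rightarrow>
   complex ^ 'n ^ 'n \<Rightarrow> complex ^ 'n ^ 'n \<Rightarrow> complex ^ 'n ^ 'n \<Rightarrow> complex ^ 'n ^ 'n \<Rightarrow>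
   complex ^ 'n ^ 'n \<Rightarrow> complex \<Rightarrow> complex \<Rightarrow> complex \<Rightarrow> nat \<times> nat \<times> nat \<Rightarrow> complex ^ 'n ^ 'n" where
  "lauricella_FD3_term A B Y A1 B1 B2 B3 C1 z w v = (\<lambda>(m, n, p).
     mscale (z ^ m * w ^ n * v ^ p / (fact m * fact n * fact p))
       (ext_mBeta A B Y (A1 + mat (of_nat (m + n + p))) (C1 - A1)
          ** matrix_inv (mBeta A1 (C1 - A1))
          ** mpochhammer B1 m ** mpochhammer B2 n ** mpochhammer B3 p))"

definition lauricella_FD3 ::
  "complex ^ 'n ^ 'n \<Rightarrow> complex ^ 'n ^ 'n \<Rightarrow> complex ^ 'n ^ 'n \<Rightarrow>
   complex ^ 'n ^ 'n \<Rightarrow> complex ^ 'n ^ 'n \<Rightarrow> complex ^ 'n ^ 'n \<Rightarrow> complex ^ 'n ^ 'n \<Rightarrow>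
   complex ^ 'n ^ 'n \<Rightarrow> complex \<Rightarrow> complex \<Rightarrow> complex \<Rightarrow> complex ^ 'n ^ 'n" where
  "lauricella_FD3 A B Y A1 B1 B2 B3 C1 z w v =
     (\<Sum>\<^sub>\<infinity>k\<in>UNIV. lauricella_FD3_term A B Y A1 B1 B2 B3 C1 z w v k)"

end

theory Submission
  imports Defs "HOL-Computational_Algebra.Fundamental_Theorem_Algebra"
begin

text \<open>
  Expanding \<open>(1 - zu) powr (- B1)\<close> and its two companions in binomial series turns the right-hand side
  into the integral of a triple series, which may be integrated termwise as soon as the
  extended beta integrand is absolutely integrable. Integrability rests on two bounds.
  First, a positive stable \<open>P\<close> is annihilated by a product of factors \<open>P - l\<close> with \<open>0 < Re l\<close>,
  and induction over these factors yields a quadratic form that decreases along \<open>X' = - P X\<close>; hence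
  \<open>u\<close> raised to \<open>P - I\<close> is \<open>O(u powr (d - 1))\<close> for some \<open>0 < d\<close>.
  Second, \<open>1F1(A; B; - s Y)\<close> stays bounded as \<open>s\<close> tends to infinity although \<open>A\<close>, \<open>B\<close> and \<open>Y\<close>
  need not commute: it solves a Kummer equation in which \<open>A\<close>, \<open>B\<close> and \<open>Y\<close> act as
  operators, and the forms attached to \<open>A\<close> and \<open>Y\<close> combine to a Lyapunov function for it.
\<close>

text \<open>No bound for large \<open>s\<close> can be read off the series \<open>hyp1F1\<close>
  itself: its terms become huge before they cancel, and with noncommuting \<open>A\<close>,
  \<open>B\<close>, \<open>Y\<close> the problem does not reduce to scalar series. The differential
  equation helps because left multiplication by \<open>A\<close> and right multiplication by
  \<open>Y\<close> commute by associativity alone, while \<open>B\<close>, which stands between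
  them, enters the estimate only as part of a bounded perturbation of order 1/s.

  The Euclidean inner product is not enough for either bound: a positive stable matrix may have an
  indefinite Hermitian part. Hence each operator gets an inner product adapted to it, in which it is
  coercive.

  Once the integrand without shift is integrable, termwise integration costs little: on (0,1) the
  factor \<open>u ^ (m + n + p)\<close> is at most 1, so that single integrand, times the absolutely
  summable binomial coefficients, dominates all terms. The position of each matrix factor is kept
  throughout; only the scalar \<open>u ^ (m + n + p)\<close> is moved across.\<close>

lemma mscale_nth [simp]: "mscale c M $ i $ j = c * M $ i $ j"
  by (simp add: mscale_def map_matrix_def)

lemma mscale_mscale [simp]: "mscale a (mscale b M) = mscale (a * b) M"
  by (simp add: vec_eq_iff mult.assoc)

lemma mscale_one [simp]: "mscale 1 M = M"
  by (simp add: vec_eq_iff)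

lemma mscale_zero [simp]: "mscale 0 M = 0" "mscale c 0 = 0"
  by (simp_all add: vec_eq_iff)

lemma mscale_add: "mscale c (M + N) = mscale c M + mscale c N"
  by (simp add: vec_eq_iff algebra_simps)

lemma mscale_add_left: "mscale (c + d) M = mscale c M + mscale d M"
  by (simp add: vec_eq_iff algebra_simps)

lemma mscale_minus: "mscale c (- M) = mscale (- c) M"
  by (simp add: vec_eq_iff)

lemma mscale_sum: "mscale c (sum f I) = (\<Sum>i\<in>I. mscale c (f i))"
  by (induction I rule: infinite_finite_induct) (simp_all add: mscale_add)

lemma mscale_of_real: "mscale (of_real r) M = r *\<^sub>R M"
  by (simp add: vec_eq_iff) (simp add: scaleR_conv_of_real)

lemma mscale_mult_left [simp]: "mscale c M ** N = mscale c (M ** N)"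
  by (simp add: vec_eq_iff matrix_matrix_mult_def sum_distrib_left mult.assoc)

lemma mscale_mult_right [simp]: "M ** mscale c N = mscale c (M ** N)"
  by (simp add: vec_eq_iff matrix_matrix_mult_def sum_distrib_left mult.left_commute)

lemma mscale_mat: "mscale c (mat d) = mat (c * d)"
  by (simp add: vec_eq_iff mat_def)

lemma mat_mult_left: "mat c ** M = mscale c M" for M :: "complex ^ 'n ^ 'n"
  by (metis mscale_mult_left mscale_mat matrix_mul_lid mult.right_neutral)

lemma mat_mult_right: "M ** mat c = mscale c M" for M :: "complex ^ 'n ^ 'n"
  by (metis mscale_mult_right mscale_mat matrix_mul_rid mult.right_neutral)

lemma matrix_add_rdistrib: "(M + N) ** L = M ** L + N ** L" for M N :: "complex ^ 'n ^ 'n"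
  by (simp add: vec_eq_iff matrix_matrix_mult_def sum.distrib distrib_right)

lemma matrix_mult_minus_left: "(- M) ** N = - (M ** N)" for M N :: "complex ^ 'n ^ 'n"
  by (simp add: vec_eq_iff matrix_matrix_mult_def sum_negf)

lemma matrix_mult_diff_left: "(M - N) ** L = M ** L - N ** L" for M N :: "complex ^ 'n ^ 'n"
  by (simp add: vec_eq_iff matrix_matrix_mult_def sum_subtractf left_diff_distrib)

lemma matrix_mult_diff_right: "L ** (M - N) = L ** M - L ** N" for M N :: "complex ^ 'n ^ 'n"
  by (simp add: vec_eq_iff matrix_matrix_mult_def sum_subtractf right_diff_distrib)

lemma matrix_mult_zero [simp]: "0 ** M = 0" "M ** 0 = 0" for M :: "complex ^ 'n ^ 'n"
  by (simp_all add: vec_eq_iff matrix_matrix_mult_def)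

lemma matrix_mult_sum_left: "sum f I ** M = (\<Sum>i\<in>I. f i ** M)" for f :: "'a \<Rightarrow> complex ^ 'n ^ 'n"
  by (induction I rule: infinite_finite_induct) (simp_all add: matrix_add_rdistrib)

lemma matrix_mult_sum_right: "M ** sum f I = (\<Sum>i\<in>I. M ** f i)" for f :: "'a \<Rightarrow> complex ^ 'n ^ 'n"
  by (induction I rule: infinite_finite_induct) (simp_all add: matrix_add_ldistrib)

section \<open>The Frobenius norm and matrix powers\<close>

lemma inner_mscale: "mscale c M \<bullet> M = Re c * (norm M)\<^sup>2"
proof -
  have *: "(c * x) \<bullet> x = Re c * (x \<bullet> x)" for x :: complex
    by (simp add: inner_complex_def algebra_simps)
  show ?thesis
    unfolding power2_norm_eq_inner inner_vec_def by (simp add: * sum_distrib_left)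
qed

lemma norm_mscale: "norm (mscale c M) = norm c * norm M"
  unfolding norm_vec_def
  by (simp add: L2_set_def norm_mult power_mult_distrib sum_distrib_left[symmetric] real_sqrt_mult)

text \<open>Since \<open>norm\<close> is the square root of the sum of all squared entries,
  Cauchy-Schwarz for each row-column product suffices.\<close>

lemma norm_matrix_mult_le: "norm (M ** N) \<le> norm M * norm N" for M N :: "complex ^ 'n ^ 'n"
proof -
  have nn: "norm L = sqrt (\<Sum>i\<in>UNIV. \<Sum>j\<in>UNIV. (norm (L $ i $ j))\<^sup>2)" for L :: "complex ^ 'n ^ 'n"
    by (simp add: norm_vec_def L2_set_def sum_nonneg)
  have e: "(norm ((M ** N) $ i $ j))\<^sup>2 \<le> (\<Sum>k\<in>UNIV. (norm (M $ i $ k))\<^sup>2) * (\<Sum>k\<in>UNIV. (norm (N $ k $ j))\<^sup>2)"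
    for i j
  proof -
    have "norm ((M ** N) $ i $ j) \<le> (\<Sum>k\<in>UNIV. \<bar>norm (M $ i $ k)\<bar> * \<bar>norm (N $ k $ j)\<bar>)"
      unfolding matrix_matrix_mult_def by (simp add: sum_norm_le norm_mult)
    also have "\<dots> \<le> L2_set (\<lambda>k. norm (M $ i $ k)) UNIV * L2_set (\<lambda>k. norm (N $ k $ j)) UNIV"
      by (rule L2_set_mult_ineq)
    finally have "(norm ((M ** N) $ i $ j))\<^sup>2 \<le> (L2_set (\<lambda>k. norm (M $ i $ k)) UNIV * L2_set (\<lambda>k. norm (N $ k $ j)) UNIV)\<^sup>2"
      by (rule power_mono) simp
    then show ?thesis
      by (simp add: power_mult_distrib L2_set_def sum_nonneg)
  qed
  have "(\<Sum>i\<in>UNIV. \<Sum>j\<in>UNIV. (norm ((M ** N) $ i $ j))\<^sup>2) \<le>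
      (\<Sum>i\<in>UNIV. \<Sum>j\<in>UNIV. (\<Sum>k\<in>UNIV. (norm (M $ i $ k))\<^sup>2) * (\<Sum>k\<in>UNIV. (norm (N $ k $ j))\<^sup>2))"
    by (intro sum_mono e)
  also have "\<dots> = (\<Sum>i\<in>UNIV. \<Sum>k\<in>UNIV. (norm (M $ i $ k))\<^sup>2) * (\<Sum>j\<in>UNIV. \<Sum>k\<in>UNIV. (norm (N $ k $ j))\<^sup>2)"
    by (simp add: sum_product)
  also have "(\<Sum>j\<in>UNIV. \<Sum>k\<in>UNIV. (norm (N $ k $ j))\<^sup>2) = (\<Sum>k\<in>UNIV. \<Sum>j\<in>UNIV. (norm (N $ k $ j))\<^sup>2)"
    by (rule sum.swap)
  finally show ?thesis
    unfolding nn by (simp add: real_sqrt_mult[symmetric])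
qed

lemma bounded_bilinear_matrix_mult:
  "bounded_bilinear ((**) :: complex ^ 'n ^ 'n \<Rightarrow> complex ^ 'n ^ 'n \<Rightarrow> complex ^ 'n ^ 'n)"
proof (intro bounded_bilinear.intro exI allI)
  show "norm (M ** N) \<le> norm M * norm N * 1" for M N :: "complex ^ 'n ^ 'n"
    using norm_matrix_mult_le[of M N] by simp
qed (simp_all add: matrix_add_rdistrib matrix_add_ldistrib mscale_of_real[symmetric])

lemma bounded_linear_mscale: "bounded_linear (mscale c)"
  by (rule bounded_linear_intro[where K="norm c"])
    (simp_all add: mscale_add norm_mscale mscale_of_real[symmetric] mult.commute)

lemma mpow_Suc': "mpow M (Suc n) = M ** mpow M n"
proof (induction n)
  case (Suc n)
  then show ?case by (metis mpow.simps(2) matrix_mul_assoc)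
qed simp

text \<open>The factor \<open>norm (mat 1)\<close> is needed already at \<open>n = 0\<close>: the
  Frobenius norm of the identity is the square root of the dimension.\<close>

lemma norm_mpow_le: "norm (mpow M n) \<le> norm (mat 1 :: complex ^ 'n ^ 'n) * norm M ^ n"
  for M :: "complex ^ 'n ^ 'n"
proof (induction n)
  case (Suc n)
  have "norm (mpow M (Suc n)) \<le> norm (mpow M n) * norm M"
    by (simp add: norm_matrix_mult_le)
  also have "\<dots> \<le> norm (mat 1 :: complex ^ 'n ^ 'n) * norm M ^ n * norm M"
    by (intro mult_right_mono Suc.IH) simp
  finally show ?case by (simp add: mult_ac)
qed simp

lemma mpow_mscale: "mpow (mscale c M) n = mscale (c ^ n) (mpow M n)"
  by (induction n) (simp_all add: mult.commute)

lemma mpow_commute: "M ** mpow M n = mpow M n ** M"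
  using mpow_Suc'[of M n] by simp

section \<open>Annihilating products of linear factors\<close>

lemma injective_imp_inverse:
  fixes M :: "complex ^ 'n ^ 'n"
  assumes "\<And>x. M *v x = 0 \<Longrightarrow> x = 0"
  obtains N where "N ** M = mat 1" "M ** N = mat 1"
proof -
  obtain N where N: "N ** M = mat 1"
    using matrix_left_invertible_ker[of M] assms by blast
  then show thesis
    using that[of N] matrix_left_right_inverse[of N M] by blast
qed

text \<open>The list holds roots with multiplicity; the Lyapunov form is built by recursion over its
  entries.\<close>

primrec lin_prod :: "complex list \<Rightarrow> complex ^ 'n ^ 'n \<Rightarrow> complex ^ 'n ^ 'n" where
  "lin_prod [] M = mat 1"
| "lin_prod (l # ls) M = lin_prod ls M ** (M - mat l)"

lemma lin_prod_commute:
  assumes "N ** M = M ** N"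
  shows "N ** lin_prod ls M = lin_prod ls M ** N"
proof (induction ls)
  case (Cons l ls)
  have "N ** (M - mat l) = (M - mat l) ** N"
    using assms by (simp add: matrix_mult_diff_left matrix_mult_diff_right mat_mult_left mat_mult_right)
  with Cons show ?case
    by (metis lin_prod.simps(2) matrix_mul_assoc)
qed simp

definition mpoly :: "complex poly \<Rightarrow> complex ^ 'n ^ 'n \<Rightarrow> complex ^ 'n ^ 'n" where
  "mpoly q M = (\<Sum>i\<le>degree q. mscale (coeff q i) (mpow M i))"

lemma mpoly_bound:
  assumes "degree q \<le> d"
  shows "mpoly q M = (\<Sum>i\<le>d. mscale (coeff q i) (mpow M i))"
  unfolding mpoly_def by (rule sum.mono_neutral_left) (use assms in \<open>auto simp: coeff_eq_0\<close>)

lemma mpoly_linear_factor: "mpoly ([:- c, 1:] * q) M = mpoly q M ** (M - mat c)"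
proof -
  define d where "d = Suc (degree q)"
  have deg: "degree ([:- c, 1:] * q) \<le> d"
    by (rule order_trans[OF degree_mult_le]) (simp add: d_def)
  have *: "coeff ([:- c, 1:] * q) 0 = - c * coeff q 0"
    "\<And>i. coeff ([:- c, 1:] * q) (Suc i) = coeff q i - c * coeff q (Suc i)" by simp_all
  have c0: "coeff q d = 0" by (simp add: d_def coeff_eq_0)
  have "mpoly ([:- c, 1:] * q) M = (\<Sum>i\<le>d. mscale (coeff ([:- c, 1:] * q) i) (mpow M i))"
    by (rule mpoly_bound[OF deg])
  also have "\<dots> = mscale (- c * coeff q 0) (mat 1)
      + (\<Sum>i\<le>degree q. mscale (coeff q i - c * coeff q (Suc i)) (mpow M (Suc i)))"
    unfolding d_def sum.atMost_Suc_shift * by simp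
  also have "(\<Sum>i\<le>degree q. mscale (coeff q i - c * coeff q (Suc i)) (mpow M (Suc i)))
     = (\<Sum>i\<le>degree q. mscale (coeff q i) (mpow M (Suc i)))
       + mscale (- c) (\<Sum>i\<le>degree q. mscale (coeff q (Suc i)) (mpow M (Suc i)))"
    by (simp add: mscale_sum sum.distrib[symmetric] mscale_add_left[symmetric] del: mpow.simps)
  also have "mscale (- c * coeff q 0) (mat 1) + (\<dots>) =
     (\<Sum>i\<le>degree q. mscale (coeff q i) (mpow M (Suc i)))
       + mscale (- c) (\<Sum>i\<le>d. mscale (coeff q i) (mpow M i))"
    unfolding d_def sum.atMost_Suc_shift by (simp add: mscale_add del: mpow.simps) (simp)
  also have "(\<Sum>i\<le>d. mscale (coeff q i) (mpow M i)) = mpoly q M"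
    by (rule mpoly_bound[symmetric]) (simp add: d_def)
  also have "(\<Sum>i\<le>degree q. mscale (coeff q i) (mpow M (Suc i))) = mpoly q M ** M"
    by (simp add: mpoly_def matrix_mult_sum_left)
  finally show ?thesis
    by (simp add: matrix_mult_diff_right mat_mult_right mscale_minus[symmetric] vec_eq_iff)
qed

text \<open>A root of \<open>q\<close> that is an eigenvalue of \<open>M\<close> goes into the list;
  at any other root the linear factor is invertible, commutes with the rest and is cancelled. So
  only eigenvalues remain, without recourse to a minimal polynomial. The matrix \<open>X\<close>
  absorbs the factors already split off.\<close>

lemma mpoly_0_imp_lin_prod_0:
  fixes M X :: "complex ^ 'n ^ 'n"
  assumes "q \<noteq> 0" "mpoly q M ** X = 0"
  shows "\<exists>ls. lin_prod ls M ** X = 0 \<and> (\<forall>l\<in>set ls. \<exists>x. x \<noteq> 0 \<and> M *v x = l *s x)"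
  using assms
proof (induction "degree q" arbitrary: q X)
  case 0
  then obtain c where q: "q = [:c:]" "c \<noteq> 0"
    by (metis degree_eq_zeroE pCons_eq_0_iff)
  then have "mscale c X = 0"
    using 0 by (simp add: mpoly_def)
  then have "mscale (1 / c) (mscale c X) = 0" by simp
  then have "X = 0" using q by simp
  then show ?case by (intro exI[of _ "[]"]) simp
next
  case (Suc d)
  then have "\<not> constant (poly q)"
    by (simp add: constant_degree)
  then obtain c where "poly q c = 0"
    using fundamental_theorem_of_algebra by blast
  then obtain q' where q: "q = [:- c, 1:] * q'"
    by (metis poly_eq_0_iff_dvd dvdE)
  with Suc.prems have "q' \<noteq> 0" by auto
  then have "degree q = Suc (degree q')"
    unfolding q by (subst degree_mult_eq) auto
  with Suc.hyps have "d = degree q'" by simp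
  have "mpoly q' M ** ((M - mat c) ** X) = 0"
    using Suc.prems(2) unfolding q mpoly_linear_factor by (simp add: matrix_mul_assoc)
  from Suc.hyps(1)[OF \<open>d = degree q'\<close> \<open>q' \<noteq> 0\<close> this]
  obtain ls where ls: "lin_prod ls M ** ((M - mat c) ** X) = 0"
    "\<forall>l\<in>set ls. \<exists>x. x \<noteq> 0 \<and> M *v x = l *s x" by blast
  show ?case
  proof (cases "\<exists>x. x \<noteq> 0 \<and> M *v x = c *s x")
    case True
    then show ?thesis
      using ls by (intro exI[of _ "c # ls"]) (simp add: matrix_mul_assoc)
  next
    case False
    have "(M - mat c) *v x = M *v x - c *s x" for x
      by (simp add: matrix_vector_mult_diff_rdistrib)
        (simp add: vec_eq_iff matrix_vector_mult_def mat_def if_distrib[of "\<lambda>a. a * _"] cong: if_cong)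
    with False have "\<And>x. (M - mat c) *v x = 0 \<Longrightarrow> x = 0" by force
    then obtain N where N: "N ** (M - mat c) = mat 1" by (rule injective_imp_inverse)
    have "(M - mat c) ** M = M ** (M - mat c)"
      by (simp add: matrix_mult_diff_left matrix_mult_diff_right mat_mult_left mat_mult_right)
    then have "(M - mat c) ** lin_prod ls M = lin_prod ls M ** (M - mat c)"
      by (rule lin_prod_commute)
    then have "(M - mat c) ** (lin_prod ls M ** X) = 0"
      using ls(1) by (metis matrix_mul_assoc)
    then have "N ** (M - mat c) ** (lin_prod ls M ** X) = 0"
      by (simp add: matrix_mul_assoc[symmetric])
    then show ?thesis using N ls(2) by auto
  qed
qed

text \<open>One power more than the real dimension of the matrix space forces a linear relation.
  Equal powers are treated apart because dependence is a property of the set of powers, where a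
  repetition would disappear.\<close>

lemma ex_annihilating_poly:
  fixes M :: "complex ^ 'n ^ 'n"
  shows "\<exists>q. q \<noteq> 0 \<and> mpoly q M = 0"
proof (cases "inj_on (mpow M) {..DIM(complex ^ 'n ^ 'n)}")
  case False
  then obtain i j where ij: "i < j" "mpow M i = mpow M j"
    by (metis inj_onI linorder_neqE_nat)
  define q where "q = monom (1::complex) i - monom 1 j"
  have c: "coeff q k = (if k = i then 1 else 0) - (if k = j then 1 else 0)" for k
    by (simp add: q_def)
  have "mpoly q M = (\<Sum>k\<le>j. mscale (coeff q k) (mpow M k))"
  proof (rule mpoly_bound)
    show "degree q \<le> j" unfolding q_def
      using ij(1) by (intro degree_diff_le order_trans[OF degree_monom_le]) auto
  qed
  also have "\<dots> = (\<Sum>k\<in>{i, j}. mscale (coeff q k) (mpow M k))"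
    by (rule sum.mono_neutral_right) (use ij(1) in \<open>auto simp: c\<close>)
  also have "\<dots> = mscale 1 (mpow M i) + mscale (- 1) (mpow M j)"
    using ij(1) by (simp add: c)
  also have "\<dots> = 0" using ij(2) by (simp add: vec_eq_iff)
  finally have "mpoly q M = 0" .
  moreover have "coeff q i \<noteq> 0" using ij(1) by (simp add: c)
  then have "q \<noteq> 0" by auto
  ultimately show ?thesis by blast
next
  case True
  define n where "n = DIM(complex ^ 'n ^ 'n)"
  have "card (mpow M ` {..n}) > DIM(complex ^ 'n ^ 'n)"
    using True by (simp add: card_image n_def)
  then have "dependent (mpow M ` {..n})"
    using independent_bound[of "mpow M ` {..n}"] by auto
  then obtain u where u: "\<exists>v\<in>mpow M ` {..n}. u v \<noteq> 0" "(\<Sum>v\<in>mpow M ` {..n}. u v *\<^sub>R v) = 0"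
    using dependent_finite[of "mpow M ` {..n}"] by auto
  define q where "q = (\<Sum>i\<le>n. monom (complex_of_real (u (mpow M i))) i)"
  have c: "coeff q k = (if k \<le> n then of_real (u (mpow M k)) else 0)" for k
    unfolding q_def by (simp add: coeff_sum)
  have "mpoly q M = (\<Sum>k\<le>n. mscale (coeff q k) (mpow M k))"
    by (rule mpoly_bound) (rule degree_le, simp add: c)
  also have "\<dots> = (\<Sum>k\<le>n. u (mpow M k) *\<^sub>R mpow M k)"
    by (intro sum.cong) (simp_all add: c mscale_of_real)
  also have "\<dots> = 0"
    using u(2) True by (subst (asm) sum.reindex) (simp_all add: n_def o_def)
  finally have "mpoly q M = 0" .
  moreover obtain k where "k \<le> n" "u (mpow M k) \<noteq> 0" using u(1) by auto
  then have "coeff q k \<noteq> 0" by (simp add: c)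
  then have "q \<noteq> 0" by auto
  ultimately show ?thesis by blast
qed

lemma positive_stable_annihilated:
  assumes "positive_stable M"
  obtains ls where "lin_prod ls M = 0" "\<And>l. l \<in> set ls \<Longrightarrow> 0 < Re l"
proof -
  obtain q where "q \<noteq> 0" "mpoly q M = 0" using ex_annihilating_poly by blast
  then show thesis
    using mpoly_0_imp_lin_prod_0[of q M "mat 1"] assms that
    unfolding positive_stable_def by (metis matrix_mul_rid)
qed

section \<open>Lyapunov forms\<close>

text \<open>An inner product in which \<open>T\<close> is coercive: along \<open>x' = - T x\<close>
  the quantity \<open>g x x\<close> decays at least like \<open>exp (- 2 * d * t)\<close>.
  Boundedness of \<open>g\<close> supplies the opposite comparison with the squared norm.\<close>

definition lyapunov_form ::
    "('a::real_inner \<Rightarrow> 'a) \<Rightarrow> ('a \<Rightarrow> 'a \<Rightarrow> real) \<Rightarrow> real \<Rightarrow> bool" where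
  "lyapunov_form T g d \<longleftrightarrow> bounded_bilinear g \<and> (\<forall>x y. g x y = g y x) \<and> 0 < d \<and>
     (\<forall>x. (norm x)\<^sup>2 \<le> g x x \<and> d * g x x \<le> g x (T x))"

text \<open>The product of the factors \<open>T - l\<close> for an operator \<open>T\<close>, so
  that left and right multiplication by a matrix are covered by one construction.\<close>

primrec op_prod ::
    "complex list \<Rightarrow> (complex ^ 'n ^ 'n \<Rightarrow> complex ^ 'n ^ 'n) \<Rightarrow> complex ^ 'n ^ 'n \<Rightarrow> complex ^ 'n ^ 'n" where
  "op_prod [] T x = x"
| "op_prod (l # ls) T x = op_prod ls T (T x - mscale l x)"

lemma op_prod_left: "op_prod ls (\<lambda>X. M ** X) X = lin_prod ls M ** X"
  by (induction ls arbitrary: X)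
    (simp_all add: matrix_mul_assoc[symmetric] matrix_mult_diff_left mat_mult_left)

lemma op_prod_right: "op_prod ls (\<lambda>X. X ** M) X = X ** lin_prod ls M"
proof (induction ls arbitrary: X)
  case (Cons l ls)
  have "(M - mat l) ** M = M ** (M - mat l)"
    by (simp add: matrix_mult_diff_left matrix_mult_diff_right mat_mult_left mat_mult_right)
  then have c: "(M - mat l) ** lin_prod ls M = lin_prod ls M ** (M - mat l)"
    by (rule lin_prod_commute)
  have "X ** M - mscale l X = X ** (M - mat l)"
    by (simp add: matrix_mult_diff_right mat_mult_right)
  then show ?case
    using Cons c by (simp add: matrix_mul_assoc[symmetric])
qed simp

text \<open>Young's inequality, keeping half of the quadratic term in \<open>m\<close>.\<close>

lemma quadratic_lower_bound:
  fixes a m n :: real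
  assumes "0 < a"
  shows "a / 2 * m\<^sup>2 - n\<^sup>2 / (2 * a) \<le> a * m\<^sup>2 - m * n"
proof -
  have "0 \<le> (a * m - n)\<^sup>2 / (2 * a)"
    using assms by simp
  also have "(a * m - n)\<^sup>2 / (2 * a) = a * m\<^sup>2 - m * n - (a / 2 * m\<^sup>2 - n\<^sup>2 / (2 * a))"
    using assms by (simp add: power2_eq_square field_simps)
  finally show ?thesis by simp
qed

lemma bounded_bilinear_add:
  assumes "bounded_bilinear f" "bounded_bilinear g"
  shows "bounded_bilinear (\<lambda>x y. f x y + g x y)"
proof -
  interpret f: bounded_bilinear f by fact
  interpret g: bounded_bilinear g by fact
  obtain K L where "\<And>x y. norm (f x y) \<le> norm x * norm y * K" "\<And>x y. norm (g x y) \<le> norm x * norm y * L"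
    using f.bounded g.bounded by blast
  then have "norm (f x y + g x y) \<le> norm x * norm y * (K + L)" for x y
    by (metis add_mono distrib_left norm_triangle_mono)
  then show ?thesis
    by unfold_locales
      (auto simp: f.add_left f.add_right g.add_left g.add_right f.scaleR_left f.scaleR_right
        g.scaleR_left g.scaleR_right scaleR_add_right)
qed

lemma bounded_bilinear_compose_linear:
  assumes "bounded_linear h" "bounded_bilinear f"
  shows "bounded_bilinear (\<lambda>x y. h (f x y))"
proof -
  interpret f: bounded_bilinear f by fact
  interpret h: bounded_linear h by fact
  obtain K where K: "0 < K" "\<And>x y. norm (f x y) \<le> norm x * norm y * K"
    using f.pos_bounded by blast
  obtain L where L: "0 < L" "\<And>x. norm (h x) \<le> norm x * L"
    using h.pos_bounded by blast
  have "norm (h (f x y)) \<le> norm x * norm y * (K * L)" for x y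
    using order_trans[OF L(2) mult_right_mono[OF K(2), of L x y]] L(1) by (simp add: mult.assoc)
  then show ?thesis
    by unfold_locales
      (auto simp: f.add_left f.add_right h.add h.scaleR f.scaleR_left f.scaleR_right)
qed

text \<open>Induction over the factors works because the estimates are claimed only on the kernel of
  \<open>op_prod ls T\<close>, which is zero for the empty list. If \<open>x\<close> is killed by
  the longer product, then \<open>y = T x - l x\<close> is killed by the shorter one, and
  \<open>T x = l x + y\<close>. Adding a multiple of the old form at \<open>y\<close> to the squared
  norm of \<open>x\<close> lets the cross term \<open>x \<bullet> y\<close> be absorbed.\<close>

lemma lyapunov_form_aux:
  fixes T :: "complex ^ 'n ^ 'n \<Rightarrow> complex ^ 'n ^ 'n"
  assumes T: "bounded_linear T" "\<And>c x. T (mscale c x) = mscale c (T x)"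
    and ls: "\<And>l. l \<in> set ls \<Longrightarrow> 0 < Re l"
  shows "\<exists>g d. bounded_bilinear g \<and> (\<forall>x y. g x y = g y x) \<and> 0 < d \<and>
     (\<forall>x. op_prod ls T x = 0 \<longrightarrow> (norm x)\<^sup>2 \<le> g x x \<and> d * g x x \<le> g x (T x))"
  using ls
proof (induction ls)
  case Nil
  have "T 0 = 0" using T(1) by (simp add: linear_simps)
  then show ?case
    by (intro exI[of _ "(\<bullet>)"] exI[of _ 1])
      (auto simp: bounded_bilinear_inner inner_commute)
next
  case (Cons l ls)
  then obtain g d where g: "bounded_bilinear g" "\<And>x y. g x y = g y x" "0 < d"
    and gd: "\<And>x. op_prod ls T x = 0 \<Longrightarrow> (norm x)\<^sup>2 \<le> g x x \<and> d * g x x \<le> g x (T x)"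
    by auto
  define a where "a = Re l"
  have a: "0 < a" using Cons.prems by (simp add: a_def)
  \<comment> \<open>This weight makes the coercivity \<open>c * d * g y y\<close> twice the loss
    \<open>g y y / (2 * a)\<close> that Young's inequality leaves, so half of it survives.\<close>
  define c where "c = 1 / (a * d)"
  have c: "0 < c" using a g(3) by (simp add: c_def)
  define S where "S x = T x - mscale l x" for x
  have S: "bounded_linear S"
    unfolding S_def using T(1) bounded_linear_mscale by (rule bounded_linear_sub)
  define g' where "g' x y = x \<bullet> y + c * g (S x) (S y)" for x y
  \<comment> \<open>Half of each rate has been spent on the cross term.\<close>
  define d' where "d' = min (a / 2) (d / 2)"
  have "bounded_bilinear (\<lambda>x y. c * g (S x) (S y))"
    by (rule bounded_bilinear_compose_linear[OF bounded_linear_mult_right bounded_bilinear.comp[OF g(1) S S]])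
  then have "bounded_bilinear g'"
    unfolding g'_def using bounded_bilinear_inner by (rule bounded_bilinear_add[rotated])
  moreover have "g' x y = g' y x" for x y
    by (simp add: g'_def inner_commute g(2)[of "S x"])
  moreover have "0 < d'" using a g(3) by (simp add: d'_def)
  moreover have "(norm x)\<^sup>2 \<le> g' x x \<and> d' * g' x x \<le> g' x (T x)" if x: "op_prod (l # ls) T x = 0" for x
  proof -
    define y where "y = S x"
    have y: "op_prod ls T y = 0" using x by (simp add: y_def S_def)
    have y1: "(norm y)\<^sup>2 \<le> g y y" "d * g y y \<le> g y (T y)" using gd[OF y] by auto
    have gy: "0 \<le> g y y" using y1(1) by (meson order_trans zero_le_power2)
    have Tx: "T x = mscale l x + y" by (simp add: y_def S_def)
    \<comment> \<open>\<open>T\<close> commutes with \<open>S\<close> because it is linear over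
      complex scalars, not merely over the reals.\<close>
    have ST: "S (T x) = T y"
      using T by (simp add: y_def S_def linear_simps bounded_linear.linear)
    have "g' x (T x) = a * (norm x)\<^sup>2 + x \<bullet> y + c * g y (T y)"
      unfolding g'_def ST y_def[symmetric]
      by (simp add: Tx inner_add_right inner_commute[of x] inner_mscale a_def)
    moreover have "- (norm x * norm y) \<le> x \<bullet> y"
      using Cauchy_Schwarz_ineq2[of x y] by linarith
    moreover have "c * (d * g y y) \<le> c * g y (T y)"
      using y1(2) c by (intro mult_left_mono) auto
    moreover have "a / 2 * (norm x)\<^sup>2 - (norm y)\<^sup>2 / (2 * a) \<le> a * (norm x)\<^sup>2 - norm x * norm y"
      by (rule quadratic_lower_bound[OF a])
    moreover have "(norm y)\<^sup>2 / (2 * a) \<le> g y y / (2 * a)"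
      using y1(1) a by (simp add: divide_right_mono)
    moreover have "g y y / (2 * a) = c * d * g y y / 2"
      using a g(3) by (simp add: c_def)
    ultimately have "a / 2 * (norm x)\<^sup>2 + c * d * g y y / 2 \<le> g' x (T x)"
      by (simp add: mult.assoc)
    moreover have "d' * (norm x)\<^sup>2 \<le> a / 2 * (norm x)\<^sup>2"
      by (intro mult_right_mono) (auto simp: d'_def)
    moreover have "d' * (c * g y y) \<le> d / 2 * (c * g y y)"
      using gy c by (intro mult_right_mono) (auto simp: d'_def)
    moreover have "d / 2 * (c * g y y) = c * d * g y y / 2" by simp
    moreover have gxx: "g' x x = (norm x)\<^sup>2 + c * g y y"
      by (simp add: g'_def y_def power2_norm_eq_inner)
    moreover have "d' * g' x x = d' * (norm x)\<^sup>2 + d' * (c * g y y)"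
      unfolding gxx by (rule distrib_left)
    ultimately show ?thesis
      using mult_nonneg_nonneg[OF less_imp_le[OF c] gy] by (intro conjI; linarith)
  qed
  ultimately show ?case by blast
qed

lemma lyapunov_form_left:
  fixes M :: "complex ^ 'n ^ 'n"
  assumes "positive_stable M"
  obtains g d where "lyapunov_form (\<lambda>X :: complex ^ 'n ^ 'n. M ** X) g d"
proof -
  obtain ls where ls: "lin_prod ls M = 0" "\<And>l. l \<in> set ls \<Longrightarrow> 0 < Re l"
    using positive_stable_annihilated[OF assms] by blast
  have "\<exists>g d. lyapunov_form (\<lambda>X :: complex ^ 'n ^ 'n. M ** X) g d"
    using lyapunov_form_aux[of "\<lambda>X. M ** X" ls] ls
    by (simp add: op_prod_left lyapunov_form_def
        bounded_bilinear.bounded_linear_right[OF bounded_bilinear_matrix_mult])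
  then show thesis using that by blast
qed

lemma lyapunov_form_right:
  fixes M :: "complex ^ 'n ^ 'n"
  assumes "positive_stable M"
  obtains g d where "lyapunov_form (\<lambda>X :: complex ^ 'n ^ 'n. X ** M) g d"
proof -
  obtain ls where ls: "lin_prod ls M = 0" "\<And>l. l \<in> set ls \<Longrightarrow> 0 < Re l"
    using positive_stable_annihilated[OF assms] by blast
  have "\<exists>g d. lyapunov_form (\<lambda>X :: complex ^ 'n ^ 'n. X ** M) g d"
    using lyapunov_form_aux[of "\<lambda>X. X ** M" ls] ls
    by (simp add: op_prod_right lyapunov_form_def
        bounded_bilinear.bounded_linear_left[OF bounded_bilinear_matrix_mult])
  then show thesis using that by blast
qed

lemma bounded_linear_vec_lambda:
  fixes f :: "'i::finite \<Rightarrow> 'a::real_normed_vector \<Rightarrow> 'b::real_normed_vector"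
  assumes "\<And>i. bounded_linear (f i)"
  shows "bounded_linear (\<lambda>x. \<chi> i. f i x)"
proof -
  obtain K where K: "\<And>i x. norm (f i x) \<le> norm x * K i"
    using assms unfolding bounded_linear_def bounded_linear_axioms_def by metis
  show ?thesis
  proof (rule bounded_linear_intro)
    show "norm (\<chi> i. f i x) \<le> norm x * sum K UNIV" for x
      by (rule order_trans[OF norm_le_l1_cart[unfolded norm_vec_def]] | simp add: norm_vec_def)+
        (auto intro!: order_trans[OF L2_set_le_sum] sum_mono K simp: sum_distrib_left)
  qed (use assms in \<open>auto simp: vec_eq_iff linear_simps bounded_linear.linear\<close>)
qed

text \<open>Needed because the Kummer equation will be a system for a tuple of matrices, on each of
  which \<open>A\<close> and \<open>Y\<close> act separately.\<close>

lemma lyapunov_form_vec: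
  fixes T :: "'a::real_inner \<Rightarrow> 'a"
  assumes "lyapunov_form T g d"
  shows "lyapunov_form (\<lambda>H :: 'a ^ 'i. \<chi> i. T (H $ i)) (\<lambda>x y. \<Sum>i\<in>UNIV. g (x $ i) (y $ i)) d"
proof -
  have g: "bounded_bilinear g" "\<And>x y. g x y = g y x" "0 < d"
     "\<And>x. (norm x)\<^sup>2 \<le> g x x" "\<And>x. d * g x x \<le> g x (T x)"
    using assms by (auto simp: lyapunov_form_def)
  have n: "(norm x)\<^sup>2 = (\<Sum>i\<in>UNIV. (norm (x $ i))\<^sup>2)" for x :: "'a ^ 'i"
    by (simp add: norm_vec_def L2_set_def sum_nonneg)
  have bs: "bounded_bilinear (\<lambda>x y. \<Sum>i\<in>I. g (x $ i) (y $ i))" if "finite I" for I :: "'i set"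
    using that
    by (induction I) (auto intro!: bounded_bilinear_add bounded_bilinear.comp[OF g(1)]
      bounded_linear_vec_nth bounded_bilinear.intro exI[of _ 0])
  show ?thesis
    unfolding lyapunov_form_def n using bs[of UNIV] g
    by (auto simp: sum_distrib_left intro!: sum_mono)
qed

section \<open>Matrix power series\<close>

text \<open>Complex differentiability entry by entry, which reduces everything to
  \<open>has_field_derivative\<close> for scalar functions.\<close>

definition mderiv ::
    "(complex \<Rightarrow> complex ^ 'n ^ 'm) \<Rightarrow> complex ^ 'n ^ 'm \<Rightarrow> complex \<Rightarrow> bool" where
  "mderiv F F' x \<longleftrightarrow> (\<forall>i j. ((\<lambda>x. F x $ i $ j) has_field_derivative F' $ i $ j) (at x))"

lemma mderiv_mult:
  fixes F G :: "complex \<Rightarrow> complex ^ 'n ^ 'n"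
  assumes "mderiv F F' x" "mderiv G G' x"
  shows "mderiv (\<lambda>x. F x ** G x) (F' ** G x + F x ** G') x"
  using assms unfolding mderiv_def
  by (auto simp: matrix_matrix_mult_def sum.distrib[symmetric] mult.commute add.commute
      intro!: derivative_eq_intros sum.cong)

lemma mderiv_mscale:
  assumes "(f has_field_derivative f') (at x)" "mderiv F F' x"
  shows "mderiv (\<lambda>x. mscale (f x) (F x)) (mscale f' (F x) + mscale (f x) F') x"
  using assms unfolding mderiv_def
  by (auto intro!: derivative_eq_intros)

lemma mderiv_chain:
  assumes "(f has_field_derivative f') (at x)" "mderiv F F' (f x)"
  shows "mderiv (\<lambda>x. F (f x)) (mscale f' F') x"
  using assms unfolding mderiv_def
  by (auto intro: DERIV_chain2 simp: mult.commute[of f'])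

lemma has_vector_derivative_vec:
  fixes f :: "real \<Rightarrow> 'a::real_normed_vector ^ 'i"
  assumes "\<And>i. ((\<lambda>s. f s $ i) has_vector_derivative f' $ i) F"
  shows "(f has_vector_derivative f') F"
proof -
  obtain x A where F: "\<And>i. ((\<lambda>s. f s $ i) has_derivative (\<lambda>h. h *\<^sub>R f' $ i)) F"
    using assms unfolding has_vector_derivative_def by blast
  show ?thesis
    unfolding has_vector_derivative_def has_derivative_def
  proof (intro conjI vec_tendstoI bounded_linear_scaleR_left)
    fix i
    show "((\<lambda>y. ((f y - f (Lim F (\<lambda>x. x)) - (y - Lim F (\<lambda>x. x)) *\<^sub>R f') /\<^sub>R
          norm (y - Lim F (\<lambda>x. x))) $ i) \<longlongrightarrow> 0 $ i) F"
      using F[of i] unfolding has_derivative_def by simp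
  qed
qed

lemma mderiv_has_vector_derivative:
  assumes "mderiv F F' (of_real s)"
  shows "((\<lambda>s. F (of_real s)) has_vector_derivative F') (at s)"
  using assms unfolding mderiv_def
  by (intro has_vector_derivative_vec) (auto intro: has_vector_derivative_real_field)

lemma mderiv_isCont:
  assumes "mderiv F F' x"
  shows "isCont F x"
proof -
  have "((\<lambda>x. F x $ i $ j) \<longlongrightarrow> F x $ i $ j) (at x)" for i j
    using assms unfolding mderiv_def by (metis DERIV_isCont isCont_def)
  then show ?thesis
    unfolding isCont_def by (intro vec_tendstoI)
qed

lemma mderiv_zero_imp_eq:
  assumes "convex S" "\<And>x. x \<in> S \<Longrightarrow> mderiv F 0 x" "x \<in> S" "y \<in> S"
  shows "F x = F y"
proof -
  have "F x $ i $ j = F y $ i $ j" for i j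
  proof -
    have "\<exists>c. \<forall>x\<in>S. F x $ i $ j = c"
      using assms(1,2) unfolding mderiv_def
      by (intro has_field_derivative_zero_constant) (auto intro: has_field_derivative_at_within)
    then show ?thesis using assms(3,4) by metis
  qed
  then show ?thesis by (simp add: vec_eq_iff)
qed

text \<open>The exponential, the hypergeometric series along a fixed \<open>Y\<close> and the
  binomial series all have this shape, so termwise differentiation is proved once.\<close>

definition mpowser :: "(nat \<Rightarrow> complex ^ 'n ^ 'n) \<Rightarrow> complex \<Rightarrow> complex ^ 'n ^ 'n" where
  "mpowser a x = (\<Sum>n. mscale (x ^ n) (a n))"

lemma summable_mpowser_norm:
  assumes "summable (\<lambda>n. norm (a n) * R ^ n)" "norm x \<le> R"
  shows "summable (\<lambda>n. norm (mscale (x ^ n) (a n)))"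
proof (rule summable_comparison_test'[OF assms(1), of 0])
  show "norm (norm (mscale (x ^ n) (a n))) \<le> norm (a n) * R ^ n" for n
    using assms(2) by (simp add: norm_mscale norm_power mult.commute[of _ "norm (a n)"] mult_left_mono power_mono)
qed

lemma summable_mpowser:
  assumes "summable (\<lambda>n. norm (a n) * R ^ n)" "norm x \<le> R"
  shows "summable (\<lambda>n. mscale (x ^ n) (a n))"
  using summable_mpowser_norm[OF assms] by (rule summable_norm_cancel)

lemma suminf_vec_nth:
  fixes f :: "nat \<Rightarrow> 'a::real_normed_vector ^ 'i"
  shows "summable f \<Longrightarrow> suminf f $ i = (\<Sum>n. f n $ i)"
  by (rule bounded_linear.suminf[OF bounded_linear_vec_nth])

lemma summable_vec_nth:
  fixes f :: "nat \<Rightarrow> 'a::real_normed_vector ^ 'i"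
  shows "summable f \<Longrightarrow> summable (\<lambda>n. f n $ i)"
  by (rule bounded_linear.summable[OF bounded_linear_vec_nth])

lemma mpowser_nth:
  assumes "summable (\<lambda>n. norm (a n) * R ^ n)" "norm x \<le> R"
  shows "mpowser a x $ i $ j = (\<Sum>n. a n $ i $ j * x ^ n)"
  unfolding mpowser_def using summable_mpowser[OF assms]
  by (simp add: suminf_vec_nth summable_vec_nth mult.commute)

lemma summable_powser_diffs_norm:
  fixes a :: "nat \<Rightarrow> real"
  assumes "summable (\<lambda>n. a n * R ^ n)" "0 \<le> r" "r < R"
  shows "summable (\<lambda>n. real (Suc n) * a (Suc n) * r ^ n)"
proof -
  obtain q where q: "r < q" "q < R" using dense assms(3) by blast
  have "summable (\<lambda>n. diffs a n * r ^ n)"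
  proof (rule termdiff_converges[of _ q])
    show "norm r < q" using assms(2) q by simp
    show "summable (\<lambda>n. a n * x ^ n)" if "norm x < q" for x :: real
      by (rule powser_inside[OF assms(1)]) (use that q assms(2) in simp)
  qed
  then show ?thesis by (simp add: diffs_def)
qed

lemma mderiv_mpowser:
  assumes s: "summable (\<lambda>n. norm (a n) * R ^ n)" and x: "norm x < R"
  shows "mderiv (mpowser a) (mpowser (\<lambda>n. mscale (of_nat (Suc n)) (a (Suc n))) x) x"
  unfolding mderiv_def
proof (intro allI)
  fix i j
  have R: "norm (complex_of_real R) \<le> R" "norm x < norm (complex_of_real R)"
    using x norm_ge_zero[of x] by (auto simp del: norm_ge_zero)
  have "((\<lambda>x. \<Sum>n. a n $ i $ j * x ^ n) has_field_derivative (\<Sum>n. diffs (\<lambda>n. a n $ i $ j) n * x ^ n)) (at x)"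
    using summable_vec_nth[OF summable_vec_nth[OF summable_mpowser[OF s R(1)]]]
    by (intro termdiffs_strong[where K="of_real R"] R(2)) (simp add: mult.commute)
  \<comment> \<open>The entrywise formula is only known inside the disc of radius \<open>R\<close>,
    so the two functions agree near \<open>x\<close> rather than everywhere.\<close>
  moreover have "\<forall>\<^sub>F y in nhds x. mpowser a y $ i $ j = (\<Sum>n. a n $ i $ j * y ^ n)"
  proof -
    have "\<forall>\<^sub>F y in nhds x. y \<in> ball 0 R"
      using x by (intro eventually_nhds_in_open) auto
    then show ?thesis
      by (rule eventually_mono) (use mpowser_nth[OF s] in auto)
  qed
  moreover have "(\<Sum>n. diffs (\<lambda>n. a n $ i $ j) n * x ^ n) =
      mpowser (\<lambda>n. mscale (of_nat (Suc n)) (a (Suc n))) x $ i $ j"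
  proof -
    have "summable (\<lambda>n. norm (mscale (of_nat (Suc n)) (a (Suc n))) * norm x ^ n)"
      using summable_powser_diffs_norm[OF s, of "norm x"] x
      by (simp add: norm_mscale norm_of_nat del: of_nat_Suc)
    from mpowser_nth[OF this order_refl] show ?thesis
      by (simp add: diffs_def)
  qed
  ultimately show "((\<lambda>y. mpowser a y $ i $ j) has_field_derivative
      mpowser (\<lambda>n. mscale (of_nat (Suc n)) (a (Suc n))) x $ i $ j) (at x)"
    by (simp add: DERIV_cong_ev)
qed

lemma summable_fact_growth:
  fixes b :: "nat \<Rightarrow> real"
  assumes "\<And>n. 0 \<le> b n" "\<And>n. b n \<le> K * L ^ n"
  shows "summable (\<lambda>n. b n / fact n * R ^ n)"
proof (rule summable_comparison_test'[of "\<lambda>n. K * (norm (L * R) ^ n /\<^sub>R fact n)" 0])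
  show "summable (\<lambda>n. K * (norm (L * R) ^ n /\<^sub>R fact n))"
    by (intro summable_mult summable_exp_generic)
  have "norm (b n / fact n * R ^ n) \<le> K * \<bar>L\<bar> ^ n / fact n * \<bar>R\<bar> ^ n" for n
  proof -
    have "0 \<le> K" using assms(1)[of 0] assms(2)[of 0] by simp
    then have "K * L ^ n \<le> K * \<bar>L\<bar> ^ n" by (intro mult_left_mono) (auto simp: power_abs[symmetric])
    then have "b n \<le> K * \<bar>L\<bar> ^ n" using assms(2)[of n] by linarith
    then show ?thesis using assms(1)[of n]
      by (simp add: abs_mult power_abs mult_right_mono divide_right_mono)
  qed
  then show "norm (b n / fact n * R ^ n) \<le> K * (norm (L * R) ^ n /\<^sub>R fact n)" for n
    by (simp add: abs_mult power_mult_distrib field_simps)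
qed

lemma mexp_powser: "mexp (mscale c X) = mpowser (\<lambda>n. mscale (1 / fact n) (mpow X n)) c"
  by (simp add: mexp_def mpowser_def mpow_mscale mult.commute)

lemma summable_mexp_norm: "summable (\<lambda>n. norm (mscale (1 / fact n) (mpow X n)) * R ^ n)"
  using summable_fact_growth[of "\<lambda>n. norm (mpow X n)", OF _ norm_mpow_le, of R]
  by (simp add: norm_mscale norm_divide)

lemma mpowser_mult_left:
  assumes "summable (\<lambda>n. norm (a n) * R ^ n)" "norm x \<le> R"
  shows "M ** mpowser a x = mpowser (\<lambda>n. M ** a n) x"
  unfolding mpowser_def
  using bounded_linear.suminf[OF bounded_bilinear.bounded_linear_right[OF bounded_bilinear_matrix_mult]
      summable_mpowser[OF assms], of M] by simp

lemma mpowser_mult_right: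
  assumes "summable (\<lambda>n. norm (a n) * R ^ n)" "norm x \<le> R"
  shows "mpowser a x ** M = mpowser (\<lambda>n. a n ** M) x"
  unfolding mpowser_def
  using bounded_linear.suminf[OF bounded_bilinear.bounded_linear_left[OF bounded_bilinear_matrix_mult]
      summable_mpowser[OF assms], of M] by simp

lemma mexp_commute:
  assumes "M ** X = X ** M"
  shows "M ** mexp X = mexp X ** M"
proof -
  have "M ** mpow X n = mpow X n ** M" for n
  proof (induction n)
    case (Suc n)
    then show ?case using assms by (metis mpow.simps(2) matrix_mul_assoc)
  qed simp
  then show ?thesis
    using mpowser_mult_left[OF summable_mexp_norm[of X 1], of 1 M]
      mpowser_mult_right[OF summable_mexp_norm[of X 1], of 1 M] mexp_powser[of 1 X]
    by simp
qed

lemma mderiv_mexp: "mderiv (\<lambda>c. mexp (mscale c X)) (X ** mexp (mscale c X)) c"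
proof -
  have "mpowser (\<lambda>n. mscale (of_nat (Suc n)) (mscale (1 / fact (Suc n)) (mpow X (Suc n)))) c
      = X ** mexp (mscale c X)"
    unfolding mexp_powser mpowser_mult_left[OF summable_mexp_norm order_refl]
    by (simp add: mpow_commute del: of_nat_Suc)
  then show ?thesis
    using mderiv_mpowser[OF summable_mexp_norm[of X "norm c + 1"], of c]
    unfolding mexp_powser by (simp del: of_nat_Suc)
qed

lemma mexp_0 [simp]: "mexp 0 = mat 1"
proof -
  have "mexp 0 = (\<Sum>n\<in>{0}. mscale (1 / fact n) (mpow 0 n))" unfolding mexp_def
    by (rule suminf_finite) (auto simp: gr0_conv_Suc)
  then show ?thesis by simp
qed

lemma mscale_uminus_one: "mscale (- 1) M = - M"
  by (simp add: vec_eq_iff)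

text \<open>As \<open>X\<close> commutes with its exponential, the product has derivative zero and
  keeps its value at 0; this replaces a Cauchy product of the two series.\<close>

lemma mexp_minus_mult: "mexp (mscale (- c) X) ** mexp (mscale c X) = mat 1"
proof -
  define F where "F c = mexp (mscale (- c) X) ** mexp (mscale c X)" for c
  have "mderiv F 0 c" for c
  proof -
    have "mderiv (\<lambda>c. mexp (mscale (- c) X)) (mscale (- 1) (X ** mexp (mscale (- c) X))) c"
      by (rule mderiv_chain[where F="\<lambda>c. mexp (mscale c X)", OF _ mderiv_mexp])
        (auto intro!: derivative_eq_intros)
    from mderiv_mult[OF this mderiv_mexp[of X c]]
    have "mderiv F (mscale (- 1) (X ** mexp (mscale (- c) X)) ** mexp (mscale c X)
       + mexp (mscale (- c) X) ** (X ** mexp (mscale c X))) c" by (simp add: F_def[abs_def])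
    moreover have "mexp (mscale (- c) X) ** X = X ** mexp (mscale (- c) X)"
      by (rule mexp_commute[symmetric]) simp
    ultimately show ?thesis
      by (simp add: matrix_mul_assoc mscale_uminus_one matrix_mult_minus_left)
  qed
  then have "F c = F 0"
    by (intro mderiv_zero_imp_eq[of UNIV]) auto
  then show ?thesis by (simp add: F_def)
qed

text \<open>Multiplying a solution of \<open>F' = X F\<close> by the inverse exponential gives a
  constant function.\<close>

lemma mexp_unique:
  assumes "\<And>c. mderiv F (X ** F c) c" "F 0 = mat 1"
  shows "F c = mexp (mscale c X)"
proof -
  define G where "G c = mexp (mscale (- c) X) ** F c" for c
  have "mderiv G 0 c" for c
  proof -
    have "mderiv (\<lambda>c. mexp (mscale (- c) X)) (mscale (- 1) (X ** mexp (mscale (- c) X))) c"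
      by (rule mderiv_chain[where F="\<lambda>c. mexp (mscale c X)", OF _ mderiv_mexp])
        (auto intro!: derivative_eq_intros)
    from mderiv_mult[OF this assms(1)[of c]]
    have "mderiv G (mscale (- 1) (X ** mexp (mscale (- c) X)) ** F c
       + mexp (mscale (- c) X) ** (X ** F c)) c" by (simp add: G_def[abs_def])
    moreover have "mexp (mscale (- c) X) ** X = X ** mexp (mscale (- c) X)"
      by (rule mexp_commute[symmetric]) simp
    ultimately show ?thesis
      by (simp add: matrix_mul_assoc mscale_uminus_one matrix_mult_minus_left)
  qed
  then have "G c = G 0"
    by (intro mderiv_zero_imp_eq[of UNIV]) auto
  then have "mexp (mscale (- c) X) ** F c = mat 1" using assms(2) by (simp add: G_def)
  then have "mexp (mscale c X) ** mexp (mscale (- c) X) ** F c = mexp (mscale c X)"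
    by (simp add: matrix_mul_assoc[symmetric])
  then show ?thesis using mexp_minus_mult[of "- c" X] by simp
qed

text \<open>Both sides solve \<open>F' = (X + a) F\<close> with the same initial value. This turns
  the scalar shifts of exponents, by \<open>- mat 1\<close> and by \<open>mat (of_nat k)\<close>,
  into scalar powers of \<open>u\<close>.\<close>

lemma mexp_mscale_plus_mat:
  "mexp (mscale c (X + mat a)) = mscale (exp (a * c)) (mexp (mscale c X))"
proof -
  define F where "F c = mscale (exp (a * c)) (mexp (mscale c X))" for c
  have "mderiv F ((X + mat a) ** F c) c" for c
  proof -
    have "((\<lambda>c. exp (a * c)) has_field_derivative a * exp (a * c)) (at c)"
      by (auto intro!: derivative_eq_intros)
    from mderiv_mscale[OF this mderiv_mexp[of X c]] show ?thesis
      by (simp add: F_def[abs_def] matrix_add_rdistrib mat_mult_left mscale_add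
          mult.commute add.commute)
  qed
  then have "F c = mexp (mscale c (X + mat a))"
    by (rule mexp_unique) (simp add: F_def)
  then show ?thesis by (simp add: F_def)
qed

section \<open>Decay estimates\<close>

lemma bounded_bilinear_self_has_real_derivative:
  fixes g :: "'a::real_normed_vector \<Rightarrow> 'a \<Rightarrow> real"
  assumes "bounded_bilinear g" "\<And>x y. g x y = g y x" "(f has_vector_derivative f') (at s)"
  shows "((\<lambda>s. g (f s) (f s)) has_real_derivative 2 * g (f s) f') (at s)"
  using bounded_bilinear.has_vector_derivative[OF assms(1,3,3)] assms(2)[of f' "f s"]
  by (simp add: has_real_derivative_iff_has_vector_derivative)

text \<open>In the Lyapunov form the exponential decays at rate \<open>d\<close>: the weight
  \<open>exp (2 * d * t)\<close> is exactly what coercivity compensates, so \<open>\<phi>\<close>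
  cannot increase.\<close>

lemma norm_mexp_decay:
  fixes P :: "complex ^ 'n ^ 'n"
  assumes "positive_stable P"
  obtains K d where "0 < d" "0 \<le> K"
    "\<And>t. 0 \<le> t \<Longrightarrow> norm (mexp (mscale (of_real (- t)) P)) \<le> K * exp (- d * t)"
proof -
  obtain g d where "lyapunov_form (\<lambda>X :: complex ^ 'n ^ 'n. P ** X) g d"
    using lyapunov_form_left[OF assms] by blast
  then have g: "bounded_bilinear g" "\<And>x y. g x y = g y x" "0 < d"
    "\<And>x. (norm x)\<^sup>2 \<le> g x x" "\<And>x. d * g x x \<le> g x (P ** x)"
    by (auto simp: lyapunov_form_def)
  define F where "F t = mexp (mscale (of_real (- t)) P)" for t
  define \<phi> where "\<phi> t = exp (2 * d * t) * g (F t) (F t)" for t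
  have F': "(F has_vector_derivative - (P ** F t)) (at t)" for t
  proof -
    have "mderiv (\<lambda>c. mexp (mscale (- c) P)) (mscale (- 1) (P ** mexp (mscale (- of_real t) P))) (of_real t)"
      by (rule mderiv_chain[where F="\<lambda>c. mexp (mscale c P)", OF _ mderiv_mexp])
        (auto intro!: derivative_eq_intros)
    from mderiv_has_vector_derivative[OF this] show ?thesis
      by (simp add: F_def[abs_def] mscale_uminus_one)
  qed
  have "\<phi> t \<le> \<phi> 0" if "0 \<le> t" for t
  proof (rule DERIV_nonpos_imp_nonincreasing[OF that])
    fix s
    have gm: "g x (- y) = - g x y" for x y
      by (rule bounded_bilinear.minus_right[OF g(1)])
    have "(\<phi> has_real_derivative 2 * d * exp (2 * d * s) * g (F s) (F s)
        + exp (2 * d * s) * (2 * g (F s) (- (P ** F s)))) (at s)"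
      unfolding \<phi>_def
      by (rule derivative_eq_intros bounded_bilinear_self_has_real_derivative[OF g(1,2) F'] refl)+ simp
    moreover have "2 * d * exp (2 * d * s) * g (F s) (F s) + exp (2 * d * s) * (2 * g (F s) (- (P ** F s)))
       = 2 * exp (2 * d * s) * (d * g (F s) (F s) - g (F s) (P ** F s))"
      by (simp add: gm algebra_simps)
    moreover have "\<dots> \<le> 0"
      using g(5)[of "F s"] by (intro mult_nonneg_nonpos) auto
    ultimately show "\<exists>y. (\<phi> has_real_derivative y) (at s) \<and> y \<le> 0" by metis
  qed
  then have "norm (F t) \<le> sqrt (\<phi> 0) * exp (- d * t)" if "0 \<le> t" for t
  proof -
    have "(norm (F t))\<^sup>2 \<le> \<phi> 0 * (exp (- d * t))\<^sup>2"
    proof -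
      have "(norm (F t))\<^sup>2 \<le> g (F t) (F t)" by (rule g)
      also have "\<dots> = \<phi> t * (exp (- d * t))\<^sup>2"
        by (simp add: \<phi>_def power2_eq_square mult_exp_exp algebra_simps)
      also have "\<dots> \<le> \<phi> 0 * (exp (- d * t))\<^sup>2"
        using \<open>0 \<le> t \<Longrightarrow> \<phi> t \<le> \<phi> 0\<close> that by (intro mult_right_mono) auto
      finally show ?thesis .
    qed
    from real_sqrt_le_mono[OF this] show ?thesis by (simp add: real_sqrt_mult)
  qed
  moreover have "0 \<le> \<phi> 0"
    unfolding \<phi>_def using order_trans[OF zero_le_power2 g(4)] by simp
  ultimately show thesis
    using that[of d "sqrt (\<phi> 0)"] g(3) by (simp add: F_def)
qed

lemma mpowr_minus_mat_1:
  assumes "0 < u"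
  shows "mpowr (of_real u) (P + mat (of_nat k) - mat 1) = u ^ k *\<^sub>R mpowr (of_real u) (P - mat 1)"
    and "mpowr (of_real u) (P - mat 1) = inverse u *\<^sub>R mexp (mscale (of_real (ln u)) P)"
proof -
  have ln: "Ln (of_real u) = of_real (ln u)"
    using assms by (simp add: Ln_of_real)
  have e: "exp (- complex_of_real (ln u)) = of_real (inverse u)"
    using assms by (simp add: exp_minus exp_of_real)
  have "P - mat 1 = P + mat (- 1)"
    by (simp add: vec_eq_iff mat_def)
  show 2: "mpowr (of_real u) (P - mat 1) = inverse u *\<^sub>R mexp (mscale (of_real (ln u)) P)"
    unfolding mpowr_def ln \<open>P - mat 1 = P + mat (- 1)\<close> mexp_mscale_plus_mat
    by (simp only: mult_minus1 e mscale_of_real)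
  have "P + mat (of_nat k) - mat 1 = P + mat (of_nat k - 1)"
    by (simp add: vec_eq_iff mat_def)
  moreover have "exp ((of_nat k - 1) * complex_of_real (ln u)) = of_real (u ^ k * inverse u)"
  proof -
    have "exp ((of_nat k - 1) * complex_of_real (ln u)) = exp (of_real (ln u)) ^ k * exp (- complex_of_real (ln u))"
      by (simp add: exp_of_nat_mult[symmetric] mult_exp_exp algebra_simps)
    then show ?thesis using assms unfolding e by (simp add: exp_of_real)
  qed
  ultimately show "mpowr (of_real u) (P + mat (of_nat k) - mat 1) = u ^ k *\<^sub>R mpowr (of_real u) (P - mat 1)"
    unfolding 2 unfolding mpowr_def ln by (simp only: mexp_mscale_plus_mat) (simp add: mscale_of_real del: of_real_mult)
qed

text \<open>The decay estimate at \<open>t = - ln u\<close>, which is nonnegative for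
  \<open>u < 1\<close>; the \<open>- mat 1\<close> costs the factor \<open>1 / u\<close>.\<close>

lemma norm_mpowr_le:
  assumes "positive_stable P"
  obtains K d where "0 < d" "0 \<le> K"
    "\<And>u. 0 < u \<Longrightarrow> u < 1 \<Longrightarrow> norm (mpowr (of_real u) (P - mat 1)) \<le> K * u powr (d - 1)"
proof -
  obtain K d where K: "0 < d" "0 \<le> K"
    "\<And>t. 0 \<le> t \<Longrightarrow> norm (mexp (mscale (of_real (- t)) P)) \<le> K * exp (- d * t)"
    using norm_mexp_decay[OF assms] by blast
  have "norm (mpowr (of_real u) (P - mat 1)) \<le> K * u powr (d - 1)" if "0 < u" "u < 1" for u
  proof -
    have "norm (mexp (mscale (of_real (ln u)) P)) \<le> K * exp (d * ln u)"
      using K(3)[of "- ln u"] that by simp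
    then have "inverse u * norm (mexp (mscale (of_real (ln u)) P)) \<le> inverse u * (K * exp (d * ln u))"
      using that by (intro mult_left_mono) auto
    also have "inverse u * (K * exp (d * ln u)) = K * u powr (d - 1)"
      using that by (simp add: powr_diff powr_def[of u d] field_simps)
    finally show ?thesis
      using that by (simp add: mpowr_minus_mat_1(2))
  qed
  then show thesis using that K(1,2) by blast
qed

text \<open>
  With \<open>r = s h' + A h\<close> the equation decouples, up to terms of order \<open>1/s\<close>, into
  \<open>h' = - A h / s\<close> and \<open>r' = - Y r\<close>, both of which are dissipative.
\<close>

lemma kummer_equation_bounded:
  fixes h p p' :: "real \<Rightarrow> 'a::real_inner"
  assumes lin: "bounded_linear A" "bounded_linear B" "bounded_linear Y"
    and comm: "\<And>x. A (Y x) = Y (A x)"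
    and gA: "lyapunov_form A gA dA" and gY: "lyapunov_form Y gY dY"
    and h: "\<And>s. (h has_vector_derivative p s) (at s)"
    and p: "\<And>s. (p has_vector_derivative p' s) (at s)"
    and eq: "\<And>s. s *\<^sub>R p' s = - (B (p s) + s *\<^sub>R Y (p s) + A (Y (h s)))"
  shows "\<exists>K. \<forall>s\<ge>0. norm (h s) \<le> K"
proof -
  have A: "bounded_bilinear gA" "\<And>x y. gA x y = gA y x" "0 < dA"
    "\<And>x. (norm x)\<^sup>2 \<le> gA x x" "\<And>x. dA * gA x x \<le> gA x (A x)"
    using gA by (auto simp: lyapunov_form_def)
  have Y: "bounded_bilinear gY" "\<And>x y. gY x y = gY y x" "0 < dY"
    "\<And>x. (norm x)\<^sup>2 \<le> gY x x" "\<And>x. dY * gY x x \<le> gY x (Y x)"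
    using gY by (auto simp: lyapunov_form_def)
  interpret A: bounded_linear A by (rule lin)
  interpret B: bounded_linear B by (rule lin)
  interpret Y: bounded_linear Y by (rule lin)
  interpret gA: bounded_bilinear gA by (rule A)
  interpret gY: bounded_bilinear gY by (rule Y)
  \<comment> \<open>\<open>L\<close> collects what remains of \<open>r'\<close> after
    \<open>- Y r\<close> is split off. The splitting uses that \<open>A\<close> and \<open>Y\<close>
    commute: \<open>A (Y h)\<close> joins \<open>s Y p\<close> to form \<open>Y r\<close>.\<close>
  define L where "L x = x - B x + A x" for x
  have L: "bounded_linear L"
    unfolding L_def by (intro bounded_linear_add bounded_linear_sub bounded_linear_ident lin)
  interpret L: bounded_linear L by (rule L)
  define r where "r s = s *\<^sub>R p s + A (h s)" for s
  define U where "U s = gA (h s) (h s) + gY (r s) (r s)" for s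
  obtain Ka where Ka: "0 < Ka" "\<And>x y. \<bar>gA x y\<bar> \<le> norm x * norm y * Ka"
    using gA.pos_bounded by auto
  obtain Kb where Kb: "0 < Kb" "\<And>x y. \<bar>gY x (L y)\<bar> \<le> norm x * norm y * Kb"
    using bounded_bilinear.pos_bounded[OF bounded_bilinear.comp[OF Y(1) bounded_linear_ident L]] by auto
  obtain Kc where Kc: "0 < Kc" "\<And>x y. \<bar>gY x (L (A y))\<bar> \<le> norm x * norm y * Kc"
    using bounded_bilinear.pos_bounded[OF bounded_bilinear.comp[OF Y(1) bounded_linear_ident
        bounded_linear_compose[OF L lin(1)]]] by auto
  have r': "(r has_vector_derivative (L (p s) - Y (r s))) (at s)" for s
  proof -
    have "(r has_vector_derivative (s *\<^sub>R p' s + 1 *\<^sub>R p s + A (p s))) (at s)"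
      unfolding r_def
      by (rule derivative_eq_intros bounded_linear.has_vector_derivative[OF lin(1)] h p refl)+
    moreover have "s *\<^sub>R p' s + 1 *\<^sub>R p s + A (p s) = L (p s) - Y (r s)"
      unfolding eq L_def r_def by (simp add: Y.add Y.scaleR comm)
    ultimately show ?thesis by simp
  qed
  define m where "m = Ka + Kc"
  \<comment> \<open>For larger \<open>s\<close> the dissipation \<open>s * dY\<close> in
    \<open>r\<close> outweighs the self-interaction \<open>Kb\<close> and the remainder
    \<open>m\<^sup>2 / (4 * dA)\<close> of the cross terms between \<open>h\<close> and
    \<open>r\<close>, whose total constant is \<open>m\<close>.\<close>
  define s0 where "s0 = (Kb + m\<^sup>2 / (4 * dA)) / dY + 1"
  have s0: "0 < s0" unfolding s0_def using Kb A(3) Y(3) by (intro add_nonneg_pos) auto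
  have U_mono: "U s \<le> U s0" if "s0 \<le> s" for s
  proof (rule DERIV_nonpos_imp_nonincreasing[OF that])
    fix s assume s: "s0 \<le> s"
    define U' where "U' = 2 * gA (h s) (p s) + 2 * gY (r s) (L (p s) - Y (r s))"
    have "(U has_real_derivative U') (at s)"
      unfolding U_def U'_def
      by (intro DERIV_add bounded_bilinear_self_has_real_derivative A Y h r')
    moreover have "U' \<le> 0"
    proof -
      have q: "s *\<^sub>R p s = r s - A (h s)" by (simp add: r_def)
      define a where "a = norm (h s)"
      define b where "b = norm (r s)"
      \<comment> \<open>The factor \<open>s\<close> lets \<open>p\<close> be eliminated through
        \<open>s p = r - A h\<close>; as \<open>s\<close> is positive, the sign of \<open>U'\<close>
        is not affected.\<close>
      have "s * U' = 2 * gA (h s) (s *\<^sub>R p s) + 2 * gY (r s) (L (s *\<^sub>R p s)) - 2 * s * gY (r s) (Y (r s))"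
        unfolding U'_def
        by (simp add: gY.diff_right gA.scaleR_right gY.scaleR_right L.scaleR algebra_simps)
      also have "\<dots> = 2 * (gA (h s) (r s) - gA (h s) (A (h s))
          + gY (r s) (L (r s)) - gY (r s) (L (A (h s))) - s * gY (r s) (Y (r s)))"
        unfolding q by (simp add: gA.diff_right gY.diff_right L.diff)
      finally have sU: "s * U' = \<dots>" .
      have 1: "gA (h s) (r s) \<le> Ka * (a * b)" using Ka(2)[of "h s" "r s"] by (simp add: a_def b_def mult_ac)
      have 2: "dA * a\<^sup>2 \<le> gA (h s) (A (h s))"
        using order_trans[OF mult_left_mono[OF A(4)[of "h s"]] A(5)[of "h s"]] A(3) by (simp add: a_def)
      have 3: "gY (r s) (L (r s)) \<le> Kb * b\<^sup>2"
        using Kb(2)[of "r s" "r s"] by (simp add: b_def power2_eq_square mult_ac)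
      have 4: "- gY (r s) (L (A (h s))) \<le> Kc * (a * b)"
        using Kc(2)[of "r s" "h s"] by (simp add: a_def b_def mult_ac)
      have "dY * b\<^sup>2 \<le> gY (r s) (Y (r s))"
        using order_trans[OF mult_left_mono[OF Y(4)[of "r s"]] Y(5)[of "r s"]] Y(3) by (simp add: b_def)
      then have 5: "s * (dY * b\<^sup>2) \<le> s * gY (r s) (Y (r s))"
        using s s0 by (intro mult_left_mono) auto
      have 6: "m * (a * b) \<le> dA * a\<^sup>2 + m\<^sup>2 / (4 * dA) * b\<^sup>2"
      proof -
        have "0 \<le> (2 * dA * a - m * b)\<^sup>2 / (4 * dA)" using A(3) by simp
        also have "\<dots> = dA * a\<^sup>2 + m\<^sup>2 / (4 * dA) * b\<^sup>2 - m * (a * b)"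
          using A(3) by (simp add: power2_eq_square field_simps)
        finally show ?thesis by simp
      qed
      have "Kb + m\<^sup>2 / (4 * dA) \<le> s * dY"
      proof -
        have "(Kb + m\<^sup>2 / (4 * dA)) / dY \<le> s" using s by (simp add: s0_def)
        then show ?thesis using Y(3) by (simp add: pos_divide_le_eq)
      qed
      then have 7: "(Kb + m\<^sup>2 / (4 * dA)) * b\<^sup>2 \<le> s * (dY * b\<^sup>2)"
        unfolding mult.assoc[of s dY, symmetric] by (intro mult_right_mono) auto
      \<comment> \<open>The estimates are combined over abstract reals; \<open>t6\<close> is the
        Young remainder, produced in estimate 6 and paid for in estimate 7.\<close>
      have sum: "x1 - x2 + x3 - x4 - x5 \<le> 0"
        if "x1 \<le> t1" "t2 \<le> x2" "x3 \<le> t3" "- x4 \<le> t4" "t5 \<le> x5" "t1 + t4 \<le> t2 + t6" "t3 + t6 \<le> t5"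
        for x1 x2 x3 x4 x5 t1 t2 t3 t4 t5 t6 :: real
        using that by linarith
      have "gA (h s) (r s) - gA (h s) (A (h s)) + gY (r s) (L (r s)) - gY (r s) (L (A (h s)))
          - s * gY (r s) (Y (r s)) \<le> 0"
        using 1 2 3 4 5 6[unfolded m_def distrib_right[of Ka]] 7[unfolded m_def distrib_right[of Kb]]
        unfolding m_def by (rule sum)
      then have "s * U' \<le> 0" unfolding sU by simp
      then show ?thesis using s s0 by (simp add: mult_le_0_iff)
    qed
    ultimately show "\<exists>y. (U has_real_derivative y) (at s) \<and> y \<le> 0" by blast
  qed
  have large: "norm (h s) \<le> sqrt (U s0)" if "s0 \<le> s" for s
  proof -
    have "(norm (h s))\<^sup>2 \<le> gA (h s) (h s)" by (rule A)
    also have "\<dots> \<le> U s"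
      unfolding U_def using order_trans[OF zero_le_power2 Y(4)[of "r s"]] by simp
    also have "\<dots> \<le> U s0" by (rule U_mono[OF that])
    finally show ?thesis by (rule real_le_rsqrt)
  qed
  \<comment> \<open>Monotonicity of \<open>U\<close> is only available from \<open>s0\<close> on;
    below it compactness bounds \<open>h\<close>.\<close>
  have "continuous_on {0..s0} h"
    using h by (intro continuous_at_imp_continuous_on ballI) (rule has_vector_derivative_continuous)
  then have "bounded (h ` {0..s0})"
    by (intro compact_imp_bounded compact_continuous_image) auto
  then obtain K where K: "\<And>s. s \<in> {0..s0} \<Longrightarrow> norm (h s) \<le> K"
    unfolding bounded_iff by blast
  show ?thesis
  proof (intro exI[of _ "max K (sqrt (U s0))"] allI impI)
    fix s :: real assume "0 \<le> s"
    then show "norm (h s) \<le> max K (sqrt (U s0))"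
      using K[of s] large[of s] by (cases "s \<le> s0") (auto simp: le_max_iff_disj)
  qed
qed

section \<open>The confluent hypergeometric series\<close>

lemma matrix_inv_eq:
  fixes M :: "complex ^ 'n ^ 'n"
  assumes "M ** N = mat 1" "N ** M = mat 1"
  shows "matrix_inv M = N"
proof -
  have "M ** matrix_inv M = mat 1 \<and> matrix_inv M ** M = mat 1"
    unfolding matrix_inv_def by (rule someI[of _ N]) (simp add: assms)
  then show ?thesis
    by (metis assms(2) matrix_mul_assoc matrix_mul_lid matrix_mul_rid)
qed

lemma mat_mult_vec: "mat c *v x = c *s x" for x :: "complex ^ 'n"
  by (simp add: vec_eq_iff matrix_vector_mult_def mat_def if_distrib[of "\<lambda>a. a * _"] cong: if_cong)

text \<open>A kernel vector would make \<open>- of_nat n\<close> an eigenvalue of \<open>B\<close>,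
  against positive stability.\<close>

lemma positive_stable_shift_inverse:
  fixes B :: "complex ^ 'n ^ 'n"
  assumes "positive_stable B"
  obtains N where "N ** (B + mat (of_nat n)) = mat 1" "(B + mat (of_nat n)) ** N = mat 1"
proof -
  have "x = 0" if "(B + mat (of_nat n)) *v x = 0" for x
  proof (rule ccontr)
    assume "x \<noteq> 0"
    have "B *v x = (- of_nat n) *s x"
      using that by (simp add: matrix_vector_mult_add_rdistrib mat_mult_vec vec_eq_iff eq_neg_iff_add_eq_0)
    with \<open>x \<noteq> 0\<close> assms have "0 < Re (- of_nat n)" unfolding positive_stable_def by blast
    then show False by simp
  qed
  then show thesis using that injective_imp_inverse by metis
qed

lemma mpochhammer_commute:
  assumes "N ** M = M ** N"
  shows "N ** mpochhammer M n = mpochhammer M n ** N"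
proof (induction n)
  case (Suc n)
  have "N ** (M + mat (of_nat n)) = (M + mat (of_nat n)) ** N"
    using assms by (simp add: matrix_add_ldistrib matrix_add_rdistrib mat_mult_left mat_mult_right)
  with Suc show ?case by (metis mpochhammer.simps(2) matrix_mul_assoc)
qed simp

lemma mpochhammer_Suc': "mpochhammer M (Suc n) = (M + mat (of_nat n)) ** mpochhammer M n"
proof -
  have "(M + mat (of_nat n)) ** M = M ** (M + mat (of_nat n))"
    by (simp add: matrix_add_ldistrib matrix_add_rdistrib mat_mult_left mat_mult_right)
  from mpochhammer_commute[OF this] show ?thesis by simp
qed

lemma mpochhammer_inverse:
  assumes "positive_stable B"
  obtains J where "J ** mpochhammer B n = mat 1" "mpochhammer B n ** J = mat 1"
proof -
  have "\<exists>J. J ** mpochhammer B n = mat 1 \<and> mpochhammer B n ** J = mat 1"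
  proof (induction n)
    case (Suc n)
    then obtain J where J: "J ** mpochhammer B n = mat 1" "mpochhammer B n ** J = mat 1" by blast
    obtain N where N: "N ** (B + mat (of_nat n)) = mat 1" "(B + mat (of_nat n)) ** N = mat 1"
      using positive_stable_shift_inverse[OF assms] by blast
    have "N ** J ** mpochhammer B (Suc n) = N ** (J ** mpochhammer B n) ** (B + mat (of_nat n))"
      "mpochhammer B (Suc n) ** (N ** J) = mpochhammer B n ** ((B + mat (of_nat n)) ** N) ** J"
      by (simp_all only: mpochhammer.simps matrix_mul_assoc)
    then have "N ** J ** mpochhammer B (Suc n) = mat 1" "mpochhammer B (Suc n) ** (N ** J) = mat 1"
      using J N by simp_all
    then show ?case by blast
  qed (auto intro!: exI[of _ "mat 1"])
  then show thesis using that by blast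
qed

definition hyp_coeff :: "complex ^ 'n ^ 'n \<Rightarrow> complex ^ 'n ^ 'n \<Rightarrow> nat \<Rightarrow> complex ^ 'n ^ 'n" where
  "hyp_coeff A B n = mpochhammer A n ** matrix_inv (mpochhammer B n)"

text \<open>\<open>A\<close> acts from the left and \<open>B\<close> from the right, since
  \<open>(A)_n\<close> precedes the inverse of \<open>(B)_n\<close>. Taking the shifted
  \<open>B\<close> out of the inverse of \<open>(B)_(n+1)\<close> leaves the inverse of
  \<open>(B)_n\<close>. Summed over \<open>n\<close>, this relation becomes the Kummer
  equation.\<close>

lemma hyp_coeff_Suc:
  assumes "positive_stable B"
  shows "hyp_coeff A B (Suc n) ** (B + mat (of_nat n)) = (A + mat (of_nat n)) ** hyp_coeff A B n"
proof -
  let ?P = "mpochhammer B n" and ?b = "B + mat (of_nat n)"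
  obtain J where J: "J ** ?P = mat 1" "?P ** J = mat 1"
    using mpochhammer_inverse[OF assms] .
  obtain J' where J': "J' ** mpochhammer B (Suc n) = mat 1" "mpochhammer B (Suc n) ** J' = mat 1"
    using mpochhammer_inverse[OF assms] .
  have "J' ** ?b = J' ** ?b ** (?P ** J)" using J by simp
  also have "\<dots> = J' ** (?b ** ?P) ** J" by (simp add: matrix_mul_assoc)
  also have "?b ** ?P = mpochhammer B (Suc n)" by (rule mpochhammer_Suc'[symmetric])
  finally have "J' ** ?b = J" using J' by simp
  then have "mpochhammer A (Suc n) ** J' ** ?b = (A + mat (of_nat n)) ** (mpochhammer A n ** J)"
    unfolding mpochhammer_Suc' by (simp add: matrix_mul_assoc[symmetric])
  then show ?thesis
    unfolding hyp_coeff_def matrix_inv_eq[OF J(2,1)] matrix_inv_eq[OF J'(2,1)] .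
qed

lemma norm_shift_mult_le:
  "norm ((M + mat (of_nat n)) ** X) \<le> (norm M + real n) * norm X" for M X :: "complex ^ 'n ^ 'n"
proof -
  have "norm ((M + mat (of_nat n)) ** X) \<le> norm (M ** X) + norm (mscale (of_nat n) X)"
    by (simp add: matrix_add_rdistrib mat_mult_left norm_triangle_ineq)
  also have "\<dots> \<le> norm M * norm X + real n * norm X"
    using norm_matrix_mult_le[of M X] by (simp add: norm_mscale)
  finally show ?thesis by (simp add: distrib_right)
qed

text \<open>The recursion bounds the ratio of consecutive norms for large \<open>n\<close>. A crude
  geometric bound is enough, because the factorial in the series then gives convergence for every
  argument.\<close>

lemma hyp_coeff_growth:
  assumes "positive_stable B"
  obtains K where "\<And>n. norm (hyp_coeff A B n) \<le> K * 4 ^ n"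
proof -
  let ?C = "hyp_coeff A B"
  \<comment> \<open>From \<open>m\<close> on, \<open>n - norm B\<close> is at least
    \<open>n / 2\<close> and \<open>norm A + n\<close> at most \<open>2 * n\<close>, whence the
    ratio 4.\<close>
  obtain m where m: "2 * norm B + norm A + 1 \<le> real m" using real_arch_simple by blast
  define K where "K = (\<Sum>k\<le>m. norm (?C k))"
  have "norm (?C n) \<le> K * 4 ^ n" for n
  proof (cases "n \<le> m")
    case True
    have "norm (?C n) \<le> K"
      unfolding K_def by (rule member_le_sum) (use True in auto)
    also have "K \<le> K * 4 ^ n"
      using mult_left_mono[of 1 "4 ^ n" K] by (simp add: K_def sum_nonneg)
    finally show ?thesis .
  next
    case False
    then have "m \<le> n" by simp
    then show ?thesis
    proof (induction n rule: dec_induct)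
      case base
      have "norm (?C m) \<le> K"
        unfolding K_def by (rule member_le_sum) auto
      also have "K \<le> K * 4 ^ m"
        using mult_left_mono[of 1 "4 ^ m" K] by (simp add: K_def sum_nonneg)
      finally show ?case .
    next
      case (step n)
      have n: "2 * norm B + norm A + 1 \<le> real n" using m step.hyps by linarith
      have "?C (Suc n) ** (B + mat (of_nat n)) = ?C (Suc n) ** B + mscale (of_nat n) (?C (Suc n))"
        by (simp add: matrix_add_ldistrib mat_mult_right)
      then have "norm (mscale (of_nat n) (?C (Suc n))) \<le>
          norm (?C (Suc n) ** (B + mat (of_nat n))) + norm (?C (Suc n) ** B)"
        by (metis add_diff_cancel_left' norm_triangle_ineq4)
      also have "\<dots> \<le> (norm A + real n) * norm (?C n) + norm (?C (Suc n)) * norm B"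
        unfolding hyp_coeff_Suc[OF assms] by (intro add_mono norm_shift_mult_le norm_matrix_mult_le)
      finally have 1: "(real n - norm B) * norm (?C (Suc n)) \<le> (norm A + real n) * norm (?C n)"
        by (simp add: norm_mscale algebra_simps)
      have "real n / 2 * norm (?C (Suc n)) \<le> (real n - norm B) * norm (?C (Suc n))"
      proof (intro mult_right_mono)
        show "real n / 2 \<le> real n - norm B" using n norm_ge_zero[of A] by linarith
      qed simp
      also note 1
      also have "(norm A + real n) * norm (?C n) \<le> 2 * real n * norm (?C n)"
      proof (intro mult_right_mono)
        show "norm A + real n \<le> 2 * real n" using n norm_ge_zero[of B] by linarith
      qed simp
      finally have "real n * norm (?C (Suc n)) \<le> real n * (4 * norm (?C n))" by simp
      moreover have "0 < real n" using n norm_ge_zero[of A] norm_ge_zero[of B] by linarith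
      ultimately have "norm (?C (Suc n)) \<le> 4 * norm (?C n)" by (simp only: mult_le_cancel_left_pos)
      then show ?case using step.IH by simp
    qed
  qed
  then show thesis by (rule that)
qed

section \<open>Kummer's equation for the hypergeometric series and its consequence\<close>

definition hyp_term ::
    "complex ^ 'n ^ 'n \<Rightarrow> complex ^ 'n ^ 'n \<Rightarrow> complex ^ 'n ^ 'n \<Rightarrow> complex ^ 'n ^ 'n \<Rightarrow> nat \<Rightarrow> complex ^ 'n ^ 'n"
  where "hyp_term A B Y E n = mscale ((- 1) ^ n / fact n) (hyp_coeff A B n ** E ** mpow Y n)"

definition mdiffs :: "(nat \<Rightarrow> complex ^ 'n ^ 'n) \<Rightarrow> nat \<Rightarrow> complex ^ 'n ^ 'n" where
  "mdiffs a n = mscale (of_nat (Suc n)) (a (Suc n))"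

lemma summable_mdiffs:
  assumes "\<And>R. summable (\<lambda>n. norm (a n) * R ^ n)"
  shows "summable (\<lambda>n. norm (mdiffs a n) * R ^ n)"
proof -
  have "summable (\<lambda>n. norm (mdiffs a n) * \<bar>R\<bar> ^ n)"
    using summable_powser_diffs_norm[OF assms, of "\<bar>R\<bar>" "\<bar>R\<bar> + 1"]
    by (simp add: mdiffs_def norm_mscale norm_of_nat del: of_nat_Suc)
  then show ?thesis
    by (rule summable_comparison_test'[of _ 0]) (simp add: abs_mult power_abs)
qed

lemma summable_hyp_term:
  assumes "positive_stable B"
  shows "summable (\<lambda>n. norm (hyp_term A B Y E n) * R ^ n)"
proof -
  obtain K where K: "\<And>n. norm (hyp_coeff A B n) \<le> K * 4 ^ n"
    using hyp_coeff_growth[OF assms] by blast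
  let ?I = "norm (mat 1 :: complex ^ 'a ^ 'a)"
  have "norm (hyp_coeff A B n ** E ** mpow Y n) \<le> (K * norm E * ?I) * (4 * norm Y) ^ n" for n
  proof -
    have K0: "0 \<le> K" using order_trans[OF norm_ge_zero K[of 0]] by simp
    have "norm (hyp_coeff A B n ** E ** mpow Y n) \<le> norm (hyp_coeff A B n) * norm E * norm (mpow Y n)"
      by (rule order_trans[OF norm_matrix_mult_le mult_right_mono[OF norm_matrix_mult_le]]) simp
    also have "\<dots> \<le> (K * 4 ^ n) * norm E * (?I * norm Y ^ n)"
      using K0 by (intro mult_mono K norm_mpow_le) auto
    finally show ?thesis by (simp add: power_mult_distrib mult_ac)
  qed
  from summable_fact_growth[OF norm_ge_zero this, of R] show ?thesis
    by (simp add: hyp_term_def norm_mscale norm_divide norm_power)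
qed

lemma mpowser_sums:
  assumes "summable (\<lambda>n. norm (a n) * R ^ n)" "norm x \<le> R"
  shows "(\<lambda>n. mscale (x ^ n) (a n)) sums mpowser a x"
  unfolding mpowser_def using summable_mpowser[OF assms] by (simp add: summable_sums)

lemma mpowser_unique:
  "(\<lambda>n. mscale (x ^ n) (a n)) sums L \<Longrightarrow> mpowser a x = L"
  unfolding mpowser_def by (rule sums_unique[symmetric])

text \<open>Multiplication by \<open>x\<close> shifts the coefficients; padding with 0 keeps the
  index aligned, so that series can be compared term by term.\<close>

lemma mpowser_shift_sums:
  assumes "summable (\<lambda>n. norm (a n) * R ^ n)" "norm x \<le> R"
  shows "(\<lambda>n. case n of 0 \<Rightarrow> 0 | Suc k \<Rightarrow> mscale (x ^ n) (a k)) sums mscale x (mpowser a x)"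
proof -
  have "(\<lambda>n. mscale x (mscale (x ^ n) (a n))) sums mscale x (mpowser a x)"
    by (rule bounded_linear.sums[OF bounded_linear_mscale mpowser_sums[OF assms]])
  then show ?thesis
    using sums_Suc_iff[of "\<lambda>n. case n of 0 \<Rightarrow> 0 | Suc k \<Rightarrow> mscale (x ^ n) (a k)"] by simp
qed

lemma mderiv_mpowser_mdiffs:
  assumes "\<And>R. summable (\<lambda>n. norm (a n) * R ^ n)"
  shows "mderiv (mpowser a) (mpowser (mdiffs a) x) x"
  using mderiv_mpowser[OF assms, of x "norm x + 1"] unfolding mdiffs_def[abs_def] by simp

text \<open>Comparison of coefficients: at \<open>x ^ n\<close> the identity is the recursion for
  \<open>hyp_coeff\<close> applied to \<open>E ** mpow Y (Suc n)\<close>. The recursion puts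
  \<open>B\<close> to the right of the coefficient, next to \<open>E\<close>, which is why
  \<open>hyp_term\<close> carries the free factor \<open>E\<close>. In the scalar case this is
  Kummer's equation for the argument \<open>- x * y\<close>.\<close>

lemma hyp_kummer_equation:
  fixes A B Y E :: "complex ^ 'n ^ 'n"
  assumes "positive_stable B"
  defines "a \<equiv> hyp_term A B Y"
  shows "mscale x (mpowser (mdiffs (mdiffs (a E))) x) =
     - (mpowser (mdiffs (a (B ** E))) x + mscale x (mpowser (mdiffs (a E)) x ** Y)
        + A ** (mpowser (a E) x ** Y))"
proof -
  have s: "summable (\<lambda>n. norm (a E n) * R ^ n)" for E R
    unfolding a_def by (rule summable_hyp_term[OF assms(1)])
  note sd = summable_mdiffs[OF s]
  note sdd = summable_mdiffs[OF sd]
  note lin = bounded_linear.sums[OF bounded_bilinear.bounded_linear_left[OF bounded_bilinear_matrix_mult]]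
    and lin' = bounded_linear.sums[OF bounded_bilinear.bounded_linear_right[OF bounded_bilinear_matrix_mult]]
  have S1: "(\<lambda>n. case n of 0 \<Rightarrow> 0 | Suc k \<Rightarrow> mscale (x ^ n) (mdiffs (mdiffs (a E)) k))
      sums mscale x (mpowser (mdiffs (mdiffs (a E))) x)"
    by (rule mpowser_shift_sums[OF sdd order_refl])
  have S2: "(\<lambda>n. mscale (x ^ n) (mdiffs (a (B ** E)) n)) sums mpowser (mdiffs (a (B ** E))) x"
    by (rule mpowser_sums[OF sd order_refl])
  have S3: "(\<lambda>n. (case n of 0 \<Rightarrow> 0 | Suc k \<Rightarrow> mscale (x ^ n) (mdiffs (a E) k)) ** Y)
      sums mscale x (mpowser (mdiffs (a E)) x ** Y)"
    unfolding mscale_mult_left[symmetric] by (rule lin[OF mpowser_shift_sums[OF sd order_refl]])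
  have S4: "(\<lambda>n. A ** (mscale (x ^ n) (a E n) ** Y)) sums (A ** (mpowser (a E) x ** Y))"
    by (rule lin'[OF lin[OF mpowser_sums[OF s order_refl]]])
  have "(\<lambda>n. (case n of 0 \<Rightarrow> 0 | Suc k \<Rightarrow> mscale (x ^ n) (mdiffs (mdiffs (a E)) k)) +
      (mscale (x ^ n) (mdiffs (a (B ** E)) n) +
       (case n of 0 \<Rightarrow> 0 | Suc k \<Rightarrow> mscale (x ^ n) (mdiffs (a E) k)) ** Y +
       A ** (mscale (x ^ n) (a E n) ** Y))) = (\<lambda>n. 0)"
  proof
    fix n
    define \<sigma> :: complex where "\<sigma> = (- 1) ^ n / fact n"
    define Z where "Z = E ** mpow Y (Suc n)"
    have d1: "mdiffs (a E') n = - mscale \<sigma> (hyp_coeff A B (Suc n) ** (E' ** mpow Y (Suc n)))" for E'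
      by (simp add: mdiffs_def a_def hyp_term_def \<sigma>_def matrix_mul_assoc mscale_uminus_one[symmetric]
          divide_simps del: mpow.simps of_nat_Suc)
    \<comment> \<open>After the shift the derivative's factor \<open>Suc k\<close> reads
      \<open>n\<close>; it vanishes at \<open>n = 0\<close>, in agreement with the padding.\<close>
    have d2: "(case n of 0 \<Rightarrow> 0 | Suc k \<Rightarrow> mscale (x ^ n) (mdiffs (mdiffs (a E)) k))
        = mscale (x ^ n) (mscale (of_nat n) (mdiffs (a E) n))"
      by (cases n) (simp_all add: mdiffs_def[of "mdiffs (a E)"] del: of_nat_Suc)
    have d3: "(case n of 0 \<Rightarrow> 0 | Suc k \<Rightarrow> mscale (x ^ n) (mdiffs (a E) k)) ** Y
        = mscale (x ^ n) (mscale (of_nat n * \<sigma>) (hyp_coeff A B n ** Z))"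
      by (cases n) (simp_all add: mdiffs_def a_def hyp_term_def \<sigma>_def Z_def matrix_mul_assoc
          del: of_nat_Suc)
    have d4: "A ** (a E n ** Y) = mscale \<sigma> (A ** (hyp_coeff A B n ** Z))"
      by (simp add: a_def hyp_term_def \<sigma>_def Z_def matrix_mul_assoc)
    have "hyp_coeff A B (Suc n) ** (B + mat (of_nat n)) ** Z = (A + mat (of_nat n)) ** hyp_coeff A B n ** Z"
      by (simp add: hyp_coeff_Suc[OF assms(1)])
    then have rec: "hyp_coeff A B (Suc n) ** (B ** Z) + mscale (of_nat n) (hyp_coeff A B (Suc n) ** Z)
        = A ** (hyp_coeff A B n ** Z) + mscale (of_nat n) (hyp_coeff A B n ** Z)"
      by (simp add: matrix_add_ldistrib matrix_add_rdistrib mat_mult_left mat_mult_right matrix_mul_assoc)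
    have "mscale (of_nat n) (mdiffs (a E) n) + mdiffs (a (B ** E)) n
      = - mscale \<sigma> (hyp_coeff A B (Suc n) ** (B ** Z) + mscale (of_nat n) (hyp_coeff A B (Suc n) ** Z))"
      unfolding d1 Z_def
      by (simp add: mscale_add matrix_mul_assoc mscale_minus mscale_uminus_one[symmetric] mult_ac del: mpow.simps)
    also have "\<dots> = - (mscale \<sigma> (A ** (hyp_coeff A B n ** Z)) + mscale (of_nat n * \<sigma>) (hyp_coeff A B n ** Z))"
      unfolding rec by (simp add: mscale_add mult.commute)
    finally have e: "mscale (of_nat n) (mdiffs (a E) n) + mdiffs (a (B ** E)) n
        + (mscale (of_nat n * \<sigma>) (hyp_coeff A B n ** Z) + A ** (a E n ** Y)) = 0"
      unfolding d4 by simp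
    have "mscale (x ^ n) (mscale (of_nat n) (mdiffs (a E) n)) + (mscale (x ^ n) (mdiffs (a (B ** E)) n) +
       mscale (x ^ n) (mscale (of_nat n * \<sigma>) (hyp_coeff A B n ** Z)) + mscale (x ^ n) (A ** (a E n ** Y)))
       = mscale (x ^ n) 0"
      unfolding e[symmetric] mscale_add by (simp only: add.assoc)
    then show "(case n of 0 \<Rightarrow> 0 | Suc k \<Rightarrow> mscale (x ^ n) (mdiffs (mdiffs (a E)) k)) +
      (mscale (x ^ n) (mdiffs (a (B ** E)) n) +
       (case n of 0 \<Rightarrow> 0 | Suc k \<Rightarrow> mscale (x ^ n) (mdiffs (a E) k)) ** Y +
       A ** (mscale (x ^ n) (a E n) ** Y)) = 0"
      unfolding d2 d3 by simp
  qed
  then have "(\<lambda>n. 0) sums (mscale x (mpowser (mdiffs (mdiffs (a E))) x) +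
     (mpowser (mdiffs (a (B ** E))) x + mscale x (mpowser (mdiffs (a E)) x ** Y)
        + A ** (mpowser (a E) x ** Y)))"
    using sums_add[OF S1 sums_add[OF sums_add[OF S2 S3] S4]] by simp
  from sums_unique2[OF this sums_zero] show ?thesis
    by (simp only: eq_neg_iff_add_eq_0)
qed

lemma hyp1F1_eq_mpowser: "hyp1F1 A B (mscale (- x) Y) = mpowser (hyp_term A B Y (mat 1)) x"
proof -
  have "(- x) ^ n = x ^ n * (- 1) ^ n" for n
    by (simp add: power_minus[of x] mult.commute)
  then show ?thesis
    unfolding hyp1F1_def mpowser_def hyp_term_def hyp_coeff_def by (simp add: mpow_mscale)
qed

lemma mpowser_sum:
  assumes "\<And>k R. summable (\<lambda>n. norm (b k n) * R ^ n)"
  shows "mpowser (\<lambda>n. \<Sum>k\<in>I. mscale (c k) (b k n)) x = (\<Sum>k\<in>I. mscale (c k) (mpowser (b k) x))"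
proof (rule mpowser_unique)
  have "(\<lambda>n. \<Sum>k\<in>I. mscale (c k) (mscale (x ^ n) (b k n))) sums (\<Sum>k\<in>I. mscale (c k) (mpowser (b k) x))"
    by (intro sums_sum bounded_linear.sums[OF bounded_linear_mscale] mpowser_sums[OF assms order_refl])
  then show "(\<lambda>n. mscale (x ^ n) (\<Sum>k\<in>I. mscale (c k) (b k n))) sums (\<Sum>k\<in>I. mscale (c k) (mpowser (b k) x))"
    by (simp add: mscale_sum mult.commute)
qed

definition munit :: "'n \<Rightarrow> 'n \<Rightarrow> complex ^ 'n ^ 'n" where
  "munit i j = (\<chi> a b. if a = i then (if b = j then 1 else 0) else 0)"

lemma mult_munit: "B ** munit i j = (\<Sum>k\<in>UNIV. mscale (B $ k $ i) (munit k j))"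
  by (simp add: vec_eq_iff matrix_matrix_mult_def munit_def if_distrib[of "\<lambda>x. _ * x"] cong: if_cong)

lemma mat_1_eq_sum_munit: "mat 1 = (\<Sum>j\<in>UNIV. munit j j)"
  by (auto simp: vec_eq_iff mat_def munit_def)

lemma hyp_term_sum:
  "hyp_term A B Y (\<Sum>k\<in>I. mscale (c k) (E k)) = (\<lambda>n. \<Sum>k\<in>I. mscale (c k) (hyp_term A B Y (E k) n))"
  by (rule ext)
    (simp add: hyp_term_def matrix_mult_sum_right matrix_mult_sum_left mscale_sum mult.commute)

lemma mdiffs_sum: "mdiffs (\<lambda>n. \<Sum>k\<in>I. mscale (c k) (b k n)) = (\<lambda>n. \<Sum>k\<in>I. mscale (c k) (mdiffs (b k) n))"
  by (rule ext) (simp add: mdiffs_def mscale_sum mult.commute)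

text \<open>
  The Kummer equation for the series of \<open>E\<close> involves the series of \<open>B ** E\<close>, so it only closes up
  once \<open>E\<close> ranges over all matrix units with a fixed second index.
\<close>

lemma hyp_series_bounded_munit:
  fixes A B Y :: "complex ^ 'n ^ 'n"
  assumes "positive_stable A" "positive_stable B" "positive_stable Y"
  shows "\<exists>K. \<forall>s\<ge>0. norm (mpowser (hyp_term A B Y (munit j j)) (of_real s)) \<le> K"
proof -
  define a where "a i = hyp_term A B Y (munit i j)" for i
  have sa: "summable (\<lambda>n. norm (a i n) * R ^ n)" for i R
    unfolding a_def by (rule summable_hyp_term[OF assms(2)])
  define h p p' :: "real \<Rightarrow> (complex ^ 'n ^ 'n) ^ 'n"
    where "h s = (\<chi> i. mpowser (a i) (of_real s))"
      and "p s = (\<chi> i. mpowser (mdiffs (a i)) (of_real s))"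
      and "p' s = (\<chi> i. mpowser (mdiffs (mdiffs (a i))) (of_real s))" for s
  \<comment> \<open>The tuple is indexed by the first index of the matrix units. \<open>AA\<close>
    and \<open>YY\<close> multiply every component on opposite sides and hence commute, whatever
    \<open>A\<close> and \<open>Y\<close> are; \<open>BB\<close> mixes components through the
    \<open>i\<close>-th column of \<open>B\<close>.\<close>
  define AA BB YY :: "(complex ^ 'n ^ 'n) ^ 'n \<Rightarrow> (complex ^ 'n ^ 'n) ^ 'n"
    where "AA H = (\<chi> i. A ** H $ i)"
      and "BB H = (\<chi> i. \<Sum>k\<in>UNIV. mscale (B $ k $ i) (H $ k))"
      and "YY H = (\<chi> i. H $ i ** Y)" for H
  obtain g d where "lyapunov_form (\<lambda>X :: complex ^ 'n ^ 'n. A ** X) g d"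
    using lyapunov_form_left[OF assms(1)] by blast
  then have gA: "lyapunov_form AA (\<lambda>x y. \<Sum>i\<in>UNIV. g (x $ i) (y $ i)) d"
    unfolding AA_def[abs_def] by (rule lyapunov_form_vec)
  obtain g' d' where "lyapunov_form (\<lambda>X :: complex ^ 'n ^ 'n. X ** Y) g' d'"
    using lyapunov_form_right[OF assms(3)] by blast
  then have gY: "lyapunov_form YY (\<lambda>x y. \<Sum>i\<in>UNIV. g' (x $ i) (y $ i)) d'"
    unfolding YY_def[abs_def] by (rule lyapunov_form_vec)
  note nth = bounded_linear_vec_nth
  have "bounded_linear AA" "bounded_linear BB" "bounded_linear YY"
    unfolding AA_def[abs_def] BB_def[abs_def] YY_def[abs_def]
    by (intro bounded_linear_vec_lambda bounded_linear_sum bounded_linear_compose[OF _ nth]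
        bounded_linear_mscale bounded_bilinear.bounded_linear_left[OF bounded_bilinear_matrix_mult]
        bounded_bilinear.bounded_linear_right[OF bounded_bilinear_matrix_mult])+
  moreover have "AA (YY x) = YY (AA x)" for x
    by (simp add: AA_def YY_def vec_eq_iff matrix_mul_assoc)
  moreover have "(h has_vector_derivative p s) (at s)" for s
    unfolding h_def[abs_def] p_def
    by (intro has_vector_derivative_vec[where f="\<lambda>s. \<chi> i. f i s" for f])
      (simp add: mderiv_has_vector_derivative mderiv_mpowser_mdiffs sa)
  moreover have "(p has_vector_derivative p' s) (at s)" for s
    unfolding p_def[abs_def] p'_def
    by (intro has_vector_derivative_vec[where f="\<lambda>s. \<chi> i. f i s" for f])
      (simp add: mderiv_has_vector_derivative mderiv_mpowser_mdiffs summable_mdiffs sa)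
  moreover have "s *\<^sub>R p' s = - (BB (p s) + s *\<^sub>R YY (p s) + AA (YY (h s)))" for s
  proof -
    have "mpowser (mdiffs (hyp_term A B Y (B ** munit i j))) x
        = (\<Sum>k\<in>UNIV. mscale (B $ k $ i) (mpowser (mdiffs (a k)) x))" for i x
      unfolding mult_munit hyp_term_sum mdiffs_sum a_def[symmetric]
      by (rule mpowser_sum) (rule summable_mdiffs[OF sa])
    then have "s *\<^sub>R mpowser (mdiffs (mdiffs (a i))) (of_real s) =
       - ((\<Sum>k\<in>UNIV. mscale (B $ k $ i) (mpowser (mdiffs (a k)) (of_real s))) +
          s *\<^sub>R (mpowser (mdiffs (a i)) (of_real s) ** Y) + A ** (mpowser (a i) (of_real s) ** Y))" for i
      using hyp_kummer_equation[OF assms(2), of "of_real s" A Y "munit i j"]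
      unfolding a_def[symmetric] by (simp add: mscale_of_real)
    then show ?thesis
      unfolding vec_eq_iff[of "s *\<^sub>R p' s"] by (simp add: p'_def p_def h_def AA_def BB_def YY_def)
  qed
  ultimately obtain K where K: "\<And>s. 0 \<le> s \<Longrightarrow> norm (h s) \<le> K"
    using kummer_equation_bounded[OF _ _ _ _ gA gY, where B=BB and h=h and p=p and p'=p'] by blast
  have "norm (mpowser (a j) (of_real s)) \<le> K" if "0 \<le> s" for s
    using order_trans[OF Finite_Cartesian_Product.norm_nth_le[of "h s" j] K[OF that]] by (simp add: h_def)
  then show ?thesis unfolding a_def by blast
qed

text \<open>The series is linear in \<open>E\<close>, and the identity is the sum of the diagonal
  matrix units, so finitely many bounded solutions add up.\<close>

lemma hyp1F1_bounded:
  fixes A B Y :: "complex ^ 'n ^ 'n"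
  assumes "positive_stable A" "positive_stable B" "positive_stable Y"
  obtains K where "0 \<le> K" "\<And>s. 0 \<le> s \<Longrightarrow> norm (hyp1F1 A B (mscale (of_real (- s)) Y)) \<le> K"
proof -
  have "\<forall>j. \<exists>K. \<forall>s\<ge>0. norm (mpowser (hyp_term A B Y (munit j j)) (of_real s)) \<le> K"
    using hyp_series_bounded_munit[OF assms] by blast
  then obtain K where K: "\<And>j s. 0 \<le> s \<Longrightarrow> norm (mpowser (hyp_term A B Y (munit j j)) (of_real s)) \<le> K j"
    by metis
  have "norm (hyp1F1 A B (mscale (of_real (- s)) Y)) \<le> (\<Sum>j\<in>UNIV. K j)" if "0 \<le> s" for s
  proof -
    have "hyp_term A B Y (mat 1) = (\<lambda>n. \<Sum>j\<in>UNIV. mscale 1 (hyp_term A B Y (munit j j) n))"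
      unfolding mat_1_eq_sum_munit using hyp_term_sum[of A B Y "\<lambda>_. 1" "\<lambda>j. munit j j" UNIV] by simp
    then have "hyp1F1 A B (mscale (of_real (- s)) Y) =
        (\<Sum>j\<in>UNIV. mscale 1 (mpowser (hyp_term A B Y (munit j j)) (of_real s)))"
      unfolding of_real_minus hyp1F1_eq_mpowser
      by (simp only:) (rule mpowser_sum, rule summable_hyp_term[OF assms(2)])
    then show ?thesis
      using K[OF that] by (simp add: sum_norm_le)
  qed
  moreover have "0 \<le> (\<Sum>j\<in>UNIV. K j)"
    by (intro sum_nonneg order_trans[OF norm_ge_zero K[of 0]]) simp
  ultimately show thesis using that by blast
qed

lemma isCont_hyp1F1:
  assumes "positive_stable B"
  shows "isCont (\<lambda>x. hyp1F1 A B (mscale x Y)) x"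
proof -
  have "isCont (mpowser (hyp_term A B Y (mat 1))) (- x)"
    by (rule mderiv_isCont[OF mderiv_mpowser_mdiffs[OF summable_hyp_term[OF assms]]])
  then have "isCont (\<lambda>x. mpowser (hyp_term A B Y (mat 1)) (- x)) x"
    by (intro isCont_o2[where f=uminus and g="mpowser (hyp_term A B Y (mat 1))"] continuous_intros)
  then show ?thesis by (simp add: hyp1F1_eq_mpowser[symmetric])
qed

section \<open>Binomial series\<close>

text \<open>Consecutive coefficients have norm ratio at most \<open>(norm B + n) / (n + 1)\<close>,
  which tends to 1; the ratio test then covers every \<open>r < 1\<close>.\<close>

lemma summable_binomial_norm:
  fixes B :: "complex ^ 'n ^ 'n"
  assumes "0 \<le> r" "r < 1"
  shows "summable (\<lambda>n. norm (mscale (1 / fact n) (mpochhammer B n)) * r ^ n)"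
proof -
  let ?b = "\<lambda>n. norm (mscale (1 / fact n) (mpochhammer B n))"
  define c where "c = (1 + r) / 2"
  have c: "r < c" "c < 1" using assms by (auto simp: c_def)
  \<comment> \<open>From \<open>N\<close> on, \<open>r * (norm B + n)\<close> is at most
    \<open>c * (n + 1)\<close>, where \<open>c\<close> is the midpoint between \<open>r\<close> and
    1.\<close>
  obtain N where N: "r * norm B / (c - r) \<le> real N" using real_arch_simple by blast
  show ?thesis
  proof (rule summable_ratio_test[OF c(2), of N])
    fix n assume "N \<le> n"
    then have "r * norm B / (c - r) \<le> real n" using N by linarith
    then have "r * norm B \<le> real n * (c - r)" using c by (simp add: pos_divide_le_eq)
    then have le: "r * (norm B + real n) \<le> c * real (Suc n)" using c assms by (simp add: algebra_simps)
    have "?b (Suc n) = norm ((B + mat (of_nat n)) ** mscale (1 / fact n) (mpochhammer B n)) / real (Suc n)"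
      unfolding mpochhammer_Suc' by (simp add: norm_mscale norm_divide norm_mult del: of_nat_Suc)
    also have "\<dots> \<le> (norm B + real n) * ?b n / real (Suc n)"
      by (intro divide_right_mono norm_shift_mult_le) simp
    finally have "?b (Suc n) * real (Suc n) \<le> (norm B + real n) * ?b n"
      by (simp add: pos_le_divide_eq del: of_nat_Suc)
    then have "?b (Suc n) * real (Suc n) * r \<le> (norm B + real n) * ?b n * r"
      using assms by (intro mult_right_mono)
    also have "\<dots> \<le> c * real (Suc n) * ?b n"
      using mult_right_mono[OF le, of "?b n"] by (simp add: mult_ac del: of_nat_Suc)
    finally have "real (Suc n) * (?b (Suc n) * r) \<le> real (Suc n) * (c * ?b n)"
      by (simp add: mult_ac del: of_nat_Suc)
    then have "?b (Suc n) * r \<le> c * ?b n"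
      by (simp only: mult_le_cancel_left_pos of_nat_0_less_iff zero_less_Suc)
    then have "?b (Suc n) * r * r ^ n \<le> c * ?b n * r ^ n"
      using assms by (intro mult_right_mono) auto
    then show "norm (?b (Suc n) * r ^ Suc n) \<le> c * norm (?b n * r ^ n)"
      using assms by (simp add: abs_mult mult_ac)
  qed
qed

text \<open>The sum satisfies \<open>(1 - x) S' = B S\<close> by the Pochhammer recursion, while
  \<open>e x\<close>, the power of \<open>1 - x\<close> with exponent \<open>B\<close>, satisfies
  the equation with the opposite sign. So \<open>e x ** S x\<close> is constant on the disc, equal
  to the identity, and \<open>S\<close> is the inverse of \<open>e\<close>.\<close>

lemma mpowr_binomial_series:
  fixes B :: "complex ^ 'n ^ 'n"
  assumes "norm x < 1"
  shows "mpowr (1 - x) (- B) = mpowser (\<lambda>n. mscale (1 / fact n) (mpochhammer B n)) x"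
proof -
  define b where "b n = mscale (1 / fact n) (mpochhammer B n)" for n
  define S where "S = mpowser b"
  define e where "e x = mexp (mscale (Ln (1 - x)) B)" for x
  have sb: "summable (\<lambda>n. norm (b n) * r ^ n)" if "0 \<le> r" "r < 1" for r
    unfolding b_def by (rule summable_binomial_norm[OF that])
  have eqS: "mscale (1 - x) (mpowser (mdiffs b) x) = B ** S x" if x: "norm x < 1" for x
  proof -
    obtain r where r: "norm x < r" "r < 1" using x dense by blast
    have r0: "0 \<le> r" using r(1) norm_ge_zero[of x] by linarith
    have sd: "summable (\<lambda>n. norm (mdiffs b n) * norm x ^ n)"
      using summable_powser_diffs_norm[OF sb[OF r0 r(2)], of "norm x"] r(1)
      by (simp add: mdiffs_def norm_mscale norm_of_nat del: of_nat_Suc)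
    have 1: "(\<lambda>n. mscale (x ^ n) (mdiffs b n)) sums mpowser (mdiffs b) x"
      by (rule mpowser_sums[OF sd order_refl])
    have 2: "(\<lambda>n. case n of 0 \<Rightarrow> 0 | Suc k \<Rightarrow> mscale (x ^ n) (mdiffs b k)) sums mscale x (mpowser (mdiffs b) x)"
      by (rule mpowser_shift_sums[OF sd order_refl])
    have 3: "(\<lambda>n. B ** mscale (x ^ n) (b n)) sums (B ** S x)"
      unfolding S_def
      by (rule bounded_linear.sums[OF bounded_bilinear.bounded_linear_right[OF bounded_bilinear_matrix_mult]
            mpowser_sums[OF sb[OF norm_ge_zero x] order_refl]])
    have "(\<lambda>n. B ** mscale (x ^ n) (b n) + (case n of 0 \<Rightarrow> 0 | Suc k \<Rightarrow> mscale (x ^ n) (mdiffs b k)))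
       = (\<lambda>n. mscale (x ^ n) (mdiffs b n))"
    proof
      fix n
      have "(case n of 0 \<Rightarrow> 0 | Suc k \<Rightarrow> mscale (x ^ n) (mdiffs b k)) = mscale (x ^ n) (mscale (of_nat n) (b n))"
        by (cases n) (simp_all add: mdiffs_def del: of_nat_Suc)
      moreover have "mdiffs b n = (B + mat (of_nat n)) ** b n"
        unfolding mdiffs_def b_def mpochhammer_Suc' by (simp del: of_nat_Suc)
      ultimately show "B ** mscale (x ^ n) (b n) + (case n of 0 \<Rightarrow> 0 | Suc k \<Rightarrow> mscale (x ^ n) (mdiffs b k))
         = mscale (x ^ n) (mdiffs b n)"
        by (simp add: matrix_add_rdistrib mat_mult_left mscale_add)
    qed
    with sums_add[OF 3 2] have "(\<lambda>n. mscale (x ^ n) (mdiffs b n)) sums (B ** S x + mscale x (mpowser (mdiffs b) x))"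
      by (simp only:)
    from sums_unique2[OF 1 this]
    have "mpowser (mdiffs b) x = B ** S x + mscale x (mpowser (mdiffs b) x)" .
    moreover have "mscale (1 - x) M = M - mscale x M" for M :: "complex ^ 'n ^ 'n"
      by (simp add: vec_eq_iff left_diff_distrib)
    ultimately show ?thesis by (simp only: diff_eq_eq)
  qed
  \<comment> \<open>On the unit disc \<open>1 - y\<close> has positive real part, so the principal
    logarithm is holomorphic there.\<close>
  have ne: "1 - y \<noteq> 0" "1 - y \<notin> \<real>\<^sub>\<le>\<^sub>0" if "norm y < 1" for y :: complex
  proof -
    have "Re y < 1" using complex_Re_le_cmod[of y] that by linarith
    then have "0 < Re (1 - y)" by simp
    then show "1 - y \<noteq> 0" "1 - y \<notin> \<real>\<^sub>\<le>\<^sub>0" by (auto simp: complex_nonpos_Reals_iff)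
  qed
  have "mderiv (\<lambda>y. e y ** S y) 0 y" if y: "norm y < 1" for y
  proof -
    obtain r where r: "norm y < r" "r < 1" using y dense by blast
    have r0: "0 \<le> r" using r(1) norm_ge_zero[of y] by linarith
    have "mderiv S (mpowser (mdiffs b) y) y"
      unfolding S_def mdiffs_def[abs_def] by (rule mderiv_mpowser[OF sb[OF r0 r(2)] r(1)])
    moreover have "mpowser (mdiffs b) y = mscale (1 / (1 - y)) (B ** S y)"
      using ne[OF y] by (simp add: eqS[OF y, symmetric])
    ultimately have S': "mderiv S (mscale (1 / (1 - y)) (B ** S y)) y" by simp
    have "((\<lambda>y. Ln (1 - y)) has_field_derivative - (1 / (1 - y))) (at y)"
      using ne[OF y] by (auto intro!: derivative_eq_intros simp: divide_simps)
    then have "mderiv e (mscale (- (1 / (1 - y))) (B ** e y)) y"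
      unfolding e_def[abs_def] by (rule mderiv_chain[where F="\<lambda>c. mexp (mscale c B)", OF _ mderiv_mexp])
    from mderiv_mult[OF this S']
    have "mderiv (\<lambda>y. e y ** S y) (mscale (- (1 / (1 - y))) (B ** e y ** S y) + mscale (1 / (1 - y)) (e y ** B ** S y)) y"
      by (simp add: matrix_mul_assoc)
    moreover have "e y ** B = B ** e y"
      unfolding e_def by (rule mexp_commute[symmetric]) simp
    moreover have "mscale (- c) M + mscale c M = 0" for c and M :: "complex ^ 'n ^ 'n"
      by (simp add: vec_eq_iff)
    ultimately show ?thesis by (simp only:)
  qed
  then have "e x ** S x = e 0 ** S 0"
    using assms by (intro mderiv_zero_imp_eq[of "ball 0 1" "\<lambda>y. e y ** S y"]) auto
  moreover have "S 0 = mat 1"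
  proof -
    have "S 0 = (\<Sum>n\<in>{0}. mscale (0 ^ n) (b n))" unfolding S_def mpowser_def
      by (rule suminf_finite) (auto simp: gr0_conv_Suc)
    then show ?thesis by (simp add: b_def)
  qed
  ultimately have "e x ** S x = mat 1" by (simp add: e_def)
  then have "mexp (mscale (- Ln (1 - x)) B) ** e x ** S x = mexp (mscale (- Ln (1 - x)) B)"
    by (simp add: matrix_mul_assoc[symmetric])
  then have "S x = mexp (mscale (- Ln (1 - x)) B)"
    unfolding e_def mexp_minus_mult by simp
  then show ?thesis
    unfolding S_def b_def[abs_def] mpowr_def by (simp add: mscale_minus)
qed

section \<open>Products of absolutely summable matrix families\<close>

lemma summable_on_matrix_product_norm:
  fixes f :: "'a \<Rightarrow> complex ^ 'n ^ 'n" and g :: "'b \<Rightarrow> complex ^ 'n ^ 'n"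
  assumes "(\<lambda>x. norm (f x)) summable_on X" "(\<lambda>y. norm (g y)) summable_on Y"
  shows "(\<lambda>(x, y). norm (f x ** g y)) summable_on X \<times> Y"
proof -
  have "(\<lambda>(x, y). norm (f x) * norm (g y)) summable_on X \<times> Y"
  proof (rule summable_on_SigmaI)
    show "((\<lambda>y. case (x, y) of (x, y) \<Rightarrow> norm (f x) * norm (g y)) has_sum norm (f x) * infsum (\<lambda>y. norm (g y)) Y) Y" for x
      using has_sum_cmult_right[OF has_sum_infsum[OF assms(2)], of "norm (f x)"] by simp
    show "(\<lambda>x. norm (f x) * infsum (\<lambda>y. norm (g y)) Y) summable_on X"
      by (rule summable_on_cmult_left[OF assms(1)])
  qed auto
  then show ?thesis
    by (rule summable_on_comparison_test) (auto simp: norm_matrix_mult_le)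
qed

lemma has_sum_matrix_product:
  fixes f :: "'a \<Rightarrow> complex ^ 'n ^ 'n" and g :: "'b \<Rightarrow> complex ^ 'n ^ 'n"
  assumes "(\<lambda>x. norm (f x)) summable_on X" "(\<lambda>y. norm (g y)) summable_on Y"
    and "(f has_sum F) X" "(g has_sum G) Y"
  shows "((\<lambda>(x, y). f x ** g y) has_sum (F ** G)) (X \<times> Y)"
proof (rule has_sum_SigmaI)
  show "((\<lambda>y. case (x, y) of (x, y) \<Rightarrow> f x ** g y) has_sum f x ** G) Y" for x
    using has_sum_bounded_linear[OF bounded_bilinear.bounded_linear_right[OF bounded_bilinear_matrix_mult]
        assms(4)] by simp
  show "((\<lambda>x. f x ** G) has_sum F ** G) X"
    by (rule has_sum_bounded_linear[OF bounded_bilinear.bounded_linear_left[OF bounded_bilinear_matrix_mult]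
        assms(3)])
  have "(\<lambda>xy. norm (case xy of (x, y) \<Rightarrow> f x ** g y)) summable_on X \<times> Y"
    using summable_on_matrix_product_norm[OF assms(1,2)] by (simp add: case_prod_unfold)
  then show "(\<lambda>(x, y). f x ** g y) summable_on X \<times> Y"
    by (rule abs_summable_summable)
qed

definition binomial_term :: "complex ^ 'n ^ 'n \<Rightarrow> complex \<Rightarrow> nat \<Rightarrow> complex ^ 'n ^ 'n" where
  "binomial_term B x m = mscale (x ^ m / fact m) (mpochhammer B m)"

lemma binomial_term_summable:
  assumes "norm x < 1"
  shows "(\<lambda>m. norm (binomial_term B x m)) summable_on UNIV"
    and "(binomial_term B x has_sum mpowr (1 - x) (- B)) UNIV"
proof -
  let ?b = "\<lambda>n. mscale (1 / fact n) (mpochhammer B n)"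
  have s: "summable (\<lambda>n. norm (?b n) * norm x ^ n)"
    by (rule summable_binomial_norm[OF norm_ge_zero assms])
  have n: "summable (\<lambda>m. norm (binomial_term B x m))"
    using summable_mpowser_norm[OF s order_refl] by (simp add: binomial_term_def)
  then show "(\<lambda>m. norm (binomial_term B x m)) summable_on UNIV"
    by (simp add: summable_on_UNIV_nonneg_real_iff)
  have "binomial_term B x sums mpowr (1 - x) (- B)"
    unfolding mpowr_binomial_series[OF assms] using mpowser_sums[OF s order_refl]
    by (simp add: binomial_term_def[abs_def])
  then show "(binomial_term B x has_sum mpowr (1 - x) (- B)) UNIV"
    by (rule norm_summable_imp_has_sum[OF n])
qed

text \<open>The bracketing follows the nesting of the index triple, so that the product rule for two
  families applies twice.\<close>

definition binomial_term3 ::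
    "complex ^ 'n ^ 'n \<Rightarrow> complex ^ 'n ^ 'n \<Rightarrow> complex ^ 'n ^ 'n \<Rightarrow> complex \<Rightarrow> complex \<Rightarrow> complex \<Rightarrow>
     nat \<times> nat \<times> nat \<Rightarrow> complex ^ 'n ^ 'n" where
  "binomial_term3 B1 B2 B3 z w v =
     (\<lambda>(m, n, p). binomial_term B1 z m ** (binomial_term B2 w n ** binomial_term B3 v p))"

lemma binomial_term3_summable:
  assumes "norm z < 1" "norm w < 1" "norm v < 1"
  shows "(\<lambda>k. norm (binomial_term3 B1 B2 B3 z w v k)) summable_on UNIV"
    and "(binomial_term3 B1 B2 B3 z w v has_sum
      mpowr (1 - z) (- B1) ** (mpowr (1 - w) (- B2) ** mpowr (1 - v) (- B3))) UNIV"
proof -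
  note 1 = binomial_term_summable[OF assms(1), of B1]
  note 2 = binomial_term_summable[OF assms(2), of B2]
  note 3 = binomial_term_summable[OF assms(3), of B3]
  have s: "(\<lambda>np. norm (case np of (n, p) \<Rightarrow> binomial_term B2 w n ** binomial_term B3 v p)) summable_on UNIV"
    using summable_on_matrix_product_norm[OF 2(1) 3(1)] by (simp add: case_prod_unfold)
  have t: "((\<lambda>(n, p). binomial_term B2 w n ** binomial_term B3 v p) has_sum
      mpowr (1 - w) (- B2) ** mpowr (1 - v) (- B3)) UNIV"
    using has_sum_matrix_product[OF 2(1) 3(1) 2(2) 3(2)] by simp
  show "(\<lambda>k. norm (binomial_term3 B1 B2 B3 z w v k)) summable_on UNIV"
    using summable_on_matrix_product_norm[OF 1(1) s]
    by (simp add: binomial_term3_def case_prod_unfold)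
  show "(binomial_term3 B1 B2 B3 z w v has_sum
      mpowr (1 - z) (- B1) ** (mpowr (1 - w) (- B2) ** mpowr (1 - v) (- B3))) UNIV"
    using has_sum_matrix_product[OF 1(1) s 1(2) t]
    by (simp add: binomial_term3_def case_prod_unfold)
qed

text \<open>All dependence on \<open>u\<close> is one real factor, which passes through the
  matrices; by \<open>ext_mBeta_integrand_shift\<close> the same factor is a shift of the first beta
  argument.\<close>

lemma binomial_term3_scale:
  "binomial_term3 B1 B2 B3 (z * of_real u) (w * of_real u) (v * of_real u) (m, n, p)
     = u ^ (m + n + p) *\<^sub>R binomial_term3 B1 B2 B3 z w v (m, n, p)"
  by (simp add: binomial_term3_def binomial_term_def mscale_of_real[symmetric] power_mult_distrib
      power_add mult_ac)

section \<open>The extended beta integrand\<close>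

lemma positive_stable_add_mat:
  assumes "positive_stable M"
  shows "positive_stable (M + mat (of_nat k))"
  unfolding positive_stable_def
proof (intro allI impI)
  fix c x assume x: "x \<noteq> 0 \<and> (M + mat (of_nat k)) *v x = c *s x"
  then have "M *v x = (c - of_nat k) *s x"
    by (simp add: matrix_vector_mult_add_rdistrib mat_mult_vec vec_eq_iff left_diff_distrib eq_diff_eq)
  with x assms have "0 < Re (c - of_nat k)" unfolding positive_stable_def by blast
  then show "0 < Re c" by simp
qed

lemma ext_mBeta_integrand_shift:
  assumes "0 < u"
  shows "ext_mBeta_integrand A B Y (P + mat (of_nat k)) Q u = u ^ k *\<^sub>R ext_mBeta_integrand A B Y P Q u"
  using mpowr_minus_mat_1(1)[OF assms, of P k]
  by (simp add: ext_mBeta_integrand_def mscale_of_real[symmetric])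

lemma continuous_on_mpowr:
  assumes "continuous_on S f" "\<And>t. t \<in> S \<Longrightarrow> 0 < f t"
  shows "continuous_on S (\<lambda>t. mpowr (of_real (f t)) M)"
proof -
  have "isCont (\<lambda>c. mexp (mscale c M)) c" for c
    by (rule mderiv_isCont[OF mderiv_mexp])
  then have "continuous_on UNIV (\<lambda>c. mexp (mscale c M))"
    by (simp add: continuous_at_imp_continuous_on)
  moreover have "continuous_on S (\<lambda>t. Ln (of_real (f t)))"
  proof (intro continuous_intros assms(1))
    show "complex_of_real (f t) \<notin> \<real>\<^sub>\<le>\<^sub>0" if "t \<in> S" for t
      using assms(2)[OF that] by (simp add: complex_nonpos_Reals_iff)
  qed
  ultimately show ?thesis
    unfolding mpowr_def by (rule continuous_on_compose2) auto
qed

lemma continuous_on_ext_mBeta_integrand: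
  assumes "positive_stable B"
  shows "continuous_on {0<..<1} (ext_mBeta_integrand A B Y P Q)"
proof -
  have "continuous_on UNIV (\<lambda>x. hyp1F1 A B (mscale x Y))"
    using isCont_hyp1F1[OF assms] by (simp add: continuous_at_imp_continuous_on)
  moreover have "continuous_on {0<..<1} (\<lambda>t :: real. complex_of_real (- 1 / (t * (1 - t))))"
    by (intro continuous_intros) auto
  ultimately have c1: "continuous_on {0<..<1} (\<lambda>t :: real. hyp1F1 A B (mscale (of_real (- 1 / (t * (1 - t)))) Y))"
    by (rule continuous_on_compose2) auto
  have c2: "continuous_on {0<..<1} (\<lambda>t :: real. mpowr (of_real t) (P - mat 1))"
    by (rule continuous_on_mpowr) auto
  have c3: "continuous_on {0<..<1} (\<lambda>t :: real. mpowr (of_real (1 - t)) (Q - mat 1))"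
    by (rule continuous_on_mpowr) (auto intro: continuous_intros)
  note mult = bounded_bilinear.continuous_on[OF bounded_bilinear_matrix_mult]
  show ?thesis
    unfolding ext_mBeta_integrand_def[abs_def] by (rule mult[OF mult[OF c1 c2] c3])
qed

text \<open>The bounded hypergeometric factor and the two power bounds give a constant multiple of a
  scalar beta integrand with exponents \<open>d1 - 1\<close> and \<open>d2 - 1\<close>; continuity
  supplies measurability.\<close>

lemma set_integrable_ext_mBeta_integrand:
  assumes "positive_stable A" "positive_stable B" "positive_stable Y"
    and "positive_stable P" "positive_stable Q"
  shows "set_integrable lborel {0<..<1} (ext_mBeta_integrand A B Y P Q)"
proof -
  obtain K where K: "0 \<le> K" "\<And>s. 0 \<le> s \<Longrightarrow> norm (hyp1F1 A B (mscale (of_real (- s)) Y)) \<le> K"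
    using hyp1F1_bounded[OF assms(1-3)] by blast
  obtain K1 d1 where K1: "0 < d1" "0 \<le> K1"
    "\<And>u. 0 < u \<Longrightarrow> u < 1 \<Longrightarrow> norm (mpowr (of_real u) (P - mat 1)) \<le> K1 * u powr (d1 - 1)"
    by (rule norm_mpowr_le[OF assms(4)], rule that)
  obtain K2 d2 where K2: "0 < d2" "0 \<le> K2"
    "\<And>u. 0 < u \<Longrightarrow> u < 1 \<Longrightarrow> norm (mpowr (of_real u) (Q - mat 1)) \<le> K2 * u powr (d2 - 1)"
    by (rule norm_mpowr_le[OF assms(5)], rule that)
  define w where "w t = K * K1 * K2 * (t powr (d1 - 1) * (1 - t) powr (d2 - 1))" for t :: real
  have "set_integrable lborel {0<..<1} w"
    unfolding w_def
    by (intro set_integrable_mult_right set_integrable_subset[OF integrable_Beta[OF K1(1) K2(1)]]) auto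
  moreover have "set_borel_measurable lborel {0<..<1} (ext_mBeta_integrand A B Y P Q)"
    using set_measurable_continuous_on[OF _ continuous_on_ext_mBeta_integrand[OF assms(2)], of A Y P Q]
    by (simp add: set_borel_measurable_def)
  moreover have "norm (ext_mBeta_integrand A B Y P Q t) \<le> norm (w t)" if "t \<in> {0<..<1}" for t
  proof -
    have t: "0 < t" "t < 1" using that by auto
    have "norm (hyp1F1 A B (mscale (of_real (- 1 / (t * (1 - t)))) Y)) \<le> K"
      using K(2)[of "1 / (t * (1 - t))"] t by simp
    moreover have "norm (mpowr (of_real t) (P - mat 1)) \<le> K1 * t powr (d1 - 1)"
      using K1(3) t by blast
    moreover have "norm (mpowr (of_real (1 - t)) (Q - mat 1)) \<le> K2 * (1 - t) powr (d2 - 1)"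
      using K2(3)[of "1 - t"] t by simp
    ultimately have "norm (hyp1F1 A B (mscale (of_real (- 1 / (t * (1 - t)))) Y)) *
        norm (mpowr (of_real t) (P - mat 1)) * norm (mpowr (of_real (1 - t)) (Q - mat 1))
        \<le> K * (K1 * t powr (d1 - 1)) * (K2 * (1 - t) powr (d2 - 1))"
      using K(1) K1(2) by (intro mult_mono) auto
    then have "norm (ext_mBeta_integrand A B Y P Q t) \<le> K * (K1 * t powr (d1 - 1)) * (K2 * (1 - t) powr (d2 - 1))"
      unfolding ext_mBeta_integrand_def
      using order_trans[OF norm_matrix_mult_le mult_right_mono[OF norm_matrix_mult_le norm_ge_zero]]
        order_trans by blast
    also have "\<dots> = w t" by (simp add: w_def mult_ac)
    finally show ?thesis by simp
  qed
  then have "AE t in lborel. t \<in> {0<..<1} \<longrightarrow> norm (ext_mBeta_integrand A B Y P Q t) \<le> norm (w t)"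
    by auto
  ultimately show ?thesis
    by (rule set_integrable_bound)
qed

text \<open>Integrals and infinite sums default to 0 where they do not converge, so the equation
  alone could hold by accident. The conclusion therefore also asserts integrability of both kinds of
  integrand and summability of the triple series.\<close>

theorem theorem5p3:
  fixes A B Y A1 B1 B2 B3 C1 :: "complex ^ 'n ^ 'n" and z w v :: complex
  assumes "positive_stable A" and "positive_stable B" and "positive_stable A1"
    and "positive_stable B1" and "positive_stable B2" and "positive_stable B3"
    and "positive_stable C1" and "positive_stable (C1 - A1)" and "positive_stable Y"
    and "A1 ** C1 = C1 ** A1"
    and "norm z < 1" and "norm w < 1" and "norm v < 1"
  defines "integrand \<equiv> (\<lambda>u::real.
      hyp1F1 A B (mscale (of_real (- 1 / (u * (1 - u)))) Y)
        ** mpowr (of_real u) (A1 - mat 1) ** mpowr (of_real (1 - u)) (C1 - A1 - mat 1)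
        ** matrix_inv (mBeta A1 (C1 - A1))
        ** mpowr (1 - z * of_real u) (- B1) ** mpowr (1 - w * of_real u) (- B2)
        ** mpowr (1 - v * of_real u) (- B3))"
  shows "(\<forall>k::nat. set_integrable lborel {0<..<1}
            (ext_mBeta_integrand A B Y (A1 + mat (of_nat k)) (C1 - A1)))
    \<and> lauricella_FD3_term A B Y A1 B1 B2 B3 C1 z w v summable_on UNIV
    \<and> set_integrable lborel {0<..<1} integrand
    \<and> lauricella_FD3 A B Y A1 B1 B2 B3 C1 z w v = (LBINT u:{0<..<1}. integrand u)"
proof -
  define Q where "Q = C1 - A1"
  define N where "N = matrix_inv (mBeta A1 Q)"
  define g where "g = ext_mBeta_integrand A B Y A1 Q"
  define I where "I = {0<..<1 :: real}"
  define T where "T = binomial_term3 B1 B2 B3 z w v"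
  define tm where "tm = lauricella_FD3_term A B Y A1 B1 B2 B3 C1 z w v"
  \<comment> \<open>The term with index \<open>k\<close> of the expanded integrand, extended by zero
    to the whole line.\<close>
  define f where "f k u = indicator I u *\<^sub>R (g u ** N ** binomial_term3 B1 B2 B3
      (z * of_real u) (w * of_real u) (v * of_real u) k)" for k u
  have beta_int: "set_integrable lborel I (ext_mBeta_integrand A B Y (A1 + mat (of_nat k)) Q)" for k
    unfolding I_def Q_def
    by (intro set_integrable_ext_mBeta_integrand positive_stable_add_mat assms)
  then have g_int: "integrable lborel (\<lambda>u. indicator I u *\<^sub>R g u)"
    unfolding g_def using beta_int[of 0] by (simp add: set_integrable_def)
  have T_sum: "(\<lambda>k. norm (T k)) summable_on UNIV"
    unfolding T_def by (rule binomial_term3_summable) fact+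
  \<comment> \<open>The power \<open>u ^ (m + n + p)\<close> moves out of the binomial terms and
    into the beta integrand, where it shifts \<open>A1\<close>; what stays on the right is constant
    in \<open>u\<close>, so the integral of each term becomes a Lauricella term.\<close>
  have f_eq: "f (m, n, p) u = indicator I u *\<^sub>R
      (ext_mBeta_integrand A B Y (A1 + mat (of_nat (m + n + p))) Q u ** (N ** T (m, n, p)))" for m n p u
    unfolding f_def binomial_term3_scale T_def g_def
    by (cases "u \<in> I")
      (simp_all add: I_def ext_mBeta_integrand_shift matrix_mul_assoc
        mscale_of_real[symmetric] del: of_nat_add)
  have lin: "bounded_linear (\<lambda>X :: complex ^ 'n ^ 'n. X ** M)" for M :: "complex ^ 'n ^ 'n"
    by (rule bounded_bilinear.bounded_linear_left[OF bounded_bilinear_matrix_mult])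
  have f_int: "integrable lborel (f k)" and f_integral: "integral\<^sup>L lborel (f k) = tm k" for k
  proof -
    obtain m n p where k: "k = (m, n, p)" using prod_cases3 by blast
    have h: "integrable lborel (\<lambda>u. indicator I u *\<^sub>R
        ext_mBeta_integrand A B Y (A1 + mat (of_nat (m + n + p))) Q u)"
      using beta_int[of "m + n + p"] by (simp only: set_integrable_def)
    have fk: "f k = (\<lambda>u. (indicator I u *\<^sub>R
        ext_mBeta_integrand A B Y (A1 + mat (of_nat (m + n + p))) Q u) ** (N ** T k))"
      by (rule ext) (simp add: k f_eq mscale_of_real[symmetric] del: of_nat_add)
    show "integrable lborel (f k)"
      unfolding fk by (rule integrable_bounded_linear[OF lin h])
    have "integral\<^sup>L lborel (f k) = ext_mBeta A B Y (A1 + mat (of_nat (m + n + p))) Q ** (N ** T k)"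
      unfolding fk ext_mBeta_def set_lebesgue_integral_def I_def[symmetric]
      by (rule integral_bounded_linear[OF lin h])
    also have "\<dots> = tm k"
      unfolding tm_def lauricella_FD3_term_def k N_def T_def binomial_term3_def binomial_term_def Q_def
      by (simp add: matrix_mul_assoc mult_ac del: of_nat_add)
    finally show "integral\<^sup>L lborel (f k) = tm k" .
  qed
  \<comment> \<open>As \<open>u ^ (m + n + p)\<close> is at most 1, the unshifted \<open>g\<close>
    serves as majorant for every \<open>k\<close>, and its dependence on \<open>k\<close> sits in
    the summable factor \<open>norm (T k)\<close>.\<close>
  have f_le: "norm (f k u) \<le> norm (indicator I u *\<^sub>R g u) * (norm N * norm (T k))" for k u
  proof (cases "u \<in> I")
    case True
    obtain m n p where k: "k = (m, n, p)" using prod_cases3 by blast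
    have u: "0 < u" "u < 1" using True by (auto simp: I_def)
    have "f k u = u ^ (m + n + p) *\<^sub>R (g u ** (N ** T k))"
      unfolding k f_eq using True u(1)
      by (simp add: ext_mBeta_integrand_shift g_def mscale_of_real[symmetric] del: of_nat_add)
    then have "norm (f k u) \<le> 1 * norm (g u ** (N ** T k))"
      using u by (simp only: norm_scaleR) (intro mult_right_mono, auto simp: power_le_one)
    also have "\<dots> \<le> norm (g u) * (norm N * norm (T k))"
      using order_trans[OF norm_matrix_mult_le mult_left_mono[OF norm_matrix_mult_le norm_ge_zero]] by simp
    finally show ?thesis using True by simp
  qed (simp add: f_def)
  define G where "G = (LINT u|lborel. norm (indicator I u *\<^sub>R g u))"
  have norm_int: "(LINT u|lborel. norm (f k u)) \<le> G * (norm N * norm (T k))" for k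
  proof -
    have "(LINT u|lborel. norm (f k u)) \<le> (LINT u|lborel. norm (indicator I u *\<^sub>R g u) * (norm N * norm (T k)))"
      by (intro integral_mono integrable_norm f_int integrable_mult_left g_int f_le)
    then show ?thesis by (simp add: G_def)
  qed
  have bound_sum: "(\<lambda>k. G * (norm N * norm (T k))) summable_on UNIV"
    by (intro summable_on_cmult_right T_sum)
  have tm_norm: "(\<lambda>k. norm (tm k)) summable_on UNIV"
  proof (rule summable_on_comparison_test[OF bound_sum])
    show "norm (tm k) \<le> G * (norm N * norm (T k))" for k
      unfolding f_integral[symmetric] by (rule order_trans[OF integral_norm_bound norm_int])
  qed simp
  then have tm_sum: "tm summable_on UNIV" by (rule abs_summable_summable)
  have f_sum: "((\<lambda>k. f k u) has_sum indicator I u *\<^sub>R integrand u) UNIV" for u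
  proof (cases "u \<in> I")
    case True
    then have u: "0 < u" "u < 1" by (auto simp: I_def)
    have n: "norm (y * of_real u) < 1" if "norm y < 1" for y :: complex
    proof -
      have "norm y * u \<le> norm y * 1" using u by (intro mult_left_mono) auto
      then show ?thesis using that u by (simp add: norm_mult)
    qed
    have "integrand u = g u ** N ** (mpowr (1 - z * of_real u) (- B1) **
        (mpowr (1 - w * of_real u) (- B2) ** mpowr (1 - v * of_real u) (- B3)))"
      unfolding integrand_def g_def N_def Q_def ext_mBeta_integrand_def by (simp only: matrix_mul_assoc)
    moreover have "((\<lambda>k. g u ** N ** binomial_term3 B1 B2 B3 (z * of_real u) (w * of_real u) (v * of_real u) k)
       has_sum (g u ** N ** (mpowr (1 - z * of_real u) (- B1) **
        (mpowr (1 - w * of_real u) (- B2) ** mpowr (1 - v * of_real u) (- B3))))) UNIV"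
      by (rule has_sum_bounded_linear[OF bounded_bilinear.bounded_linear_right[OF bounded_bilinear_matrix_mult]
            binomial_term3_summable(2)[OF n[OF assms(11)] n[OF assms(12)] n[OF assms(13)]]])
    ultimately show ?thesis using True by (simp add: f_def)
  qed (simp add: f_def)
  \<comment> \<open>Termwise integration is applied to sequences, so the triples are enumerated;
    \<open>has_sum\<close> does not depend on the enumeration chosen.\<close>
  obtain e :: "nat \<Rightarrow> nat \<times> nat \<times> nat" where e: "bij e"
    using bij_betw_from_nat_into[of "UNIV :: (nat \<times> nat \<times> nat) set"] by (auto simp: finite_prod)
  have e_summable: "summable (\<lambda>i. h (e i))" if "h summable_on UNIV" for h :: "nat \<times> nat \<times> nat \<Rightarrow> real"
    using that summable_on_reindex_bij_betw[OF e, of h] by (intro summable_on_imp_summable) blast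
  have e_sums: "(\<lambda>i. h (e i)) sums S" if "(h has_sum S) UNIV" for h :: "nat \<times> nat \<times> nat \<Rightarrow> complex ^ 'n ^ 'n" and S
    using that has_sum_reindex_bij_betw[OF e, of h S] by (intro has_sum_imp_sums) blast
  have Tn: "summable (\<lambda>i. norm (T (e i)))" by (rule e_summable[OF T_sum])
  have AE: "AE u in lborel. summable (\<lambda>i. norm (f (e i) u))"
  proof (rule AE_I2)
    fix u
    have "summable (\<lambda>i. norm (indicator I u *\<^sub>R g u) * (norm N * norm (T (e i))))"
      by (intro summable_mult Tn)
    then show "summable (\<lambda>i. norm (f (e i) u))"
      by (rule summable_comparison_test'[of _ 0]) (use f_le in simp)
  qed
  \<comment> \<open>Together with the pointwise absolute summability above, this is what the
    exchange of sum and integral requires.\<close>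
  have ints: "summable (\<lambda>i. LINT u|lborel. norm (f (e i) u))"
    by (rule summable_comparison_test'[OF e_summable[OF bound_sum], of 0]) (use norm_int in simp)
  have suminf_f: "(\<Sum>i. f (e i) u) = indicator I u *\<^sub>R integrand u" for u
    using e_sums[OF f_sum] by (simp add: sums_iff)
  have "set_integrable lborel I integrand"
    using integrable_suminf[OF f_int AE ints] unfolding suminf_f set_integrable_def .
  moreover have "infsum tm UNIV = (LBINT u:I. integrand u)"
  proof -
    have "(\<lambda>i. tm (e i)) sums (LBINT u:I. integrand u)"
      using sums_integral[OF f_int AE ints] unfolding suminf_f f_integral set_lebesgue_integral_def .
    moreover have "(\<lambda>i. tm (e i)) sums infsum tm UNIV"
      by (rule e_sums) (rule has_sum_infsum[OF tm_sum])
    ultimately show ?thesis by (rule sums_unique2[symmetric])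
  qed
  ultimately show ?thesis
    using beta_int tm_sum unfolding lauricella_FD3_def tm_def[symmetric] Q_def I_def by simp
qed

end
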